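(* Let $\mathbb{K}$ be a field of characteristic zero and let $G$ be a simple graph on the vertex set $\{0,1,\dots,n\}$. Then $\mathcal{D}^T_G$ and $\mathcal{K}^T_G$ are isomorphic as filtered algebras.
   Context: $\Phi^T_G$ is the commutative $\mathbb{K}$-algebra generated by $\phi_e$ ($e$ an edge of $G$) with relations $\phi_e^2=0$ for every edge $e$, and $\prod_{e\in H}\phi_e=0$ for every non-slim set of edges $H$, where $H$ is slim if the graph on all vertices with edge set $E(G)\setminus H$ is connected. For a vertex $i$ and edge $e$: $c_{i,e}=1$ if $e$ joins $i$ to $j$ with $i<j$, $c_{i,e}=-1$ if $e$ joins $i$ to $j$ with $i>j$, $c_{i,e}=0$ otherwise. $Y^T_i=\prod_e(1+c_{i,e}\phi_e)\in\Phi^T_G$, $i=0,\dots,n$; $\mathcal{K}^T_G$ is the subalgebra generated by $1,Y^T_0,\dots,Y^T_n$, filtered with $k$-th piece the span of products of at most $k$ of the $Y^T_i$ (empty product $1$). For a vertex set $I$, $D_I$ is the number of edges with exactly one endpoint in $I$. $\mathcal{D}^T_G=\mathbb{K}[y_0,\dots,y_n]/\mathcal{I}^T_G$ where $\mathcal{I}^T_G$ is generated by $\left(\prod_{i\in I}y_i-1\right)^{D_I}$ for all nonempty proper $I\subsetneq\{0,\dots,n\}$ together with $\prod_{i=0}^n y_i-1$; its filtration has $k$-th piece the image of polynomials of total degree at most $k$. A filtered isomorphism is an algebra isomorphism mapping the $k$-th piece onto the $k$-th piece for all $k$. *)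

theory Defs
  imports
    "HOL-Library.Poly_Mapping"
    "HOL-Algebra.QuotRing"
    "HOL-Algebra.Module"
    "HOL-Algebra.Subrings"
    "HOL-Algebra.Algebraic_Closure_Type"
begin

text \<open>
  The ground field is a type \<open>'k\<close> of class \<^class>\<open>field\<close>; as a ring record it is
  \<^const>\<open>ring_of_type_algebra\<close>. An algebra over it is a \<open>module\<close> record satisfying
  \<^locale>\<open>algebra\<close>.
\<close>

text \<open>A polynomial maps exponent vectors to coefficients.\<close>

type_synonym ('v, 'k) mpoly = "('v \<Rightarrow>\<^sub>0 nat) \<Rightarrow>\<^sub>0 'k"

definition Var :: "'v \<Rightarrow> ('v, 'k::field) mpoly" where
  "Var v = Poly_Mapping.single (Poly_Mapping.single v 1) 1"

definition Const :: "'k \<Rightarrow> ('v, 'k::field) mpoly" where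
  "Const c = Poly_Mapping.single 0 c"

definition total_degree_le :: "('v, 'k::field) mpoly \<Rightarrow> nat \<Rightarrow> bool" where
  "total_degree_le p k \<longleftrightarrow>
     (\<forall>m \<in> Poly_Mapping.keys p. (\<Sum>v\<in>Poly_Mapping.keys m. Poly_Mapping.lookup m v) \<le> k)"

definition poly_alg :: "'v set \<Rightarrow> ('k::field, ('v, 'k) mpoly) module" where
  "poly_alg V =
     \<lparr>carrier = {p. \<forall>m \<in> Poly_Mapping.keys p. Poly_Mapping.keys m \<subseteq> V},
      monoid.mult = (*), one = 1, ring.zero = 0, add = (+), module.smult = (\<lambda>c p. Const c * p)\<rparr>"

text \<open>The scalar action on cosets is written in the style of \<^const>\<open>rcoset_mult\<close>.\<close>

definition quot_alg :: "('k, 'a) module \<Rightarrow> 'a set \<Rightarrow> ('k, 'a set) module" where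
  "quot_alg A I =
     ring.extend (A Quot I)
       (module.fields (\<lambda>c S. \<Union>x\<in>S. I +>\<^bsub>A\<^esub> (c \<odot>\<^bsub>A\<^esub> x)))"

definition generated_subalg :: "('k::field, 'a) module \<Rightarrow> 'a set \<Rightarrow> ('k, 'a) module" where
  "generated_subalg A S =
     A\<lparr>carrier := \<Inter>{B. subring B A \<and> submodule B (ring_of_type_algebra :: 'k ring) A \<and> S \<subseteq> B}\<rparr>"

definition lin_span :: "('k::field, 'a) module \<Rightarrow> 'a set \<Rightarrow> 'a set" where
  "lin_span A S = \<Inter>{V. submodule V (ring_of_type_algebra :: 'k ring) A \<and> S \<subseteq> V}"

definition alg_iso :: "('k, 'a) module \<Rightarrow> ('k, 'b) module \<Rightarrow> ('a \<Rightarrow> 'b) set" where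
  "alg_iso A B =
     {h \<in> ring_iso A B. \<forall>c. \<forall>x \<in> carrier A. h (c \<odot>\<^bsub>A\<^esub> x) = c \<odot>\<^bsub>B\<^esub> h x}"

definition filtered_alg_isomorphic ::
  "('k, 'a) module \<Rightarrow> (nat \<Rightarrow> 'a set) \<Rightarrow> ('k, 'b) module \<Rightarrow> (nat \<Rightarrow> 'b set) \<Rightarrow> bool" where
  "filtered_alg_isomorphic A F B F' \<longleftrightarrow> (\<exists>h \<in> alg_iso A B. \<forall>k. h ` F k = F' k)"

definition simple_graph :: "nat \<Rightarrow> nat set set \<Rightarrow> bool" where
  "simple_graph n E \<longleftrightarrow> (\<forall>e \<in> E. e \<subseteq> {0..n} \<and> card e = 2)"

definition connected_graph :: "nat \<Rightarrow> nat set set \<Rightarrow> bool" where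
  "connected_graph n E \<longleftrightarrow> (\<forall>u \<in> {0..n}. \<forall>v \<in> {0..n}. (u, v) \<in> {(x, y). {x, y} \<in> E}\<^sup>*)"

definition slim :: "nat \<Rightarrow> nat set set \<Rightarrow> nat set set \<Rightarrow> bool" where
  "slim n E H \<longleftrightarrow> connected_graph n (E - H)"

definition cut_size :: "nat set set \<Rightarrow> nat set \<Rightarrow> nat" where
  "cut_size E I = card {e \<in> E. card (e \<inter> I) = 1}"

definition incidence :: "nat \<Rightarrow> nat set \<Rightarrow> 'k::field" where
  "incidence i e =
     (if \<exists>j. e = {i, j} \<and> i < j then 1 else if \<exists>j. e = {i, j} \<and> i > j then - 1 else 0)"

definition Phi_ideal :: "nat \<Rightarrow> nat set set \<Rightarrow> (nat set, 'k::field) mpoly set" where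
  "Phi_ideal n E =
     Idl\<^bsub>poly_alg E\<^esub> ({(Var e)\<^sup>2 | e. e \<in> E} \<union> {\<Prod>e\<in>H. Var e | H. H \<subseteq> E \<and> \<not> slim n E H})"

definition Phi_T :: "nat \<Rightarrow> nat set set \<Rightarrow> ('k::field, (nat set, 'k) mpoly set) module" where
  "Phi_T n E = quot_alg (poly_alg E) (Phi_ideal n E)"

definition phi :: "nat \<Rightarrow> nat set set \<Rightarrow> nat set \<Rightarrow> (nat set, 'k::field) mpoly set" where
  "phi n E e = Phi_ideal n E +>\<^bsub>poly_alg E\<^esub> Var e"

definition Y_T :: "nat \<Rightarrow> nat set set \<Rightarrow> nat \<Rightarrow> (nat set, 'k::field) mpoly set" where
  "Y_T n E i =
     (\<Otimes>\<^bsub>Phi_T n E\<^esub> e \<in> E.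
        \<one>\<^bsub>Phi_T n E\<^esub> \<oplus>\<^bsub>Phi_T n E\<^esub> (incidence i e \<odot>\<^bsub>Phi_T n E\<^esub> phi n E e))"

definition K_T :: "nat \<Rightarrow> nat set set \<Rightarrow> ('k::field, (nat set, 'k) mpoly set) module" where
  "K_T n E = generated_subalg (Phi_T n E) (insert \<one>\<^bsub>Phi_T n E\<^esub> (Y_T n E ` {0..n}))"

definition K_T_filtration :: "nat \<Rightarrow> nat set set \<Rightarrow> nat \<Rightarrow> (nat set, 'k::field) mpoly set set" where
  "K_T_filtration n E k =
     lin_span (Phi_T n E)
       {foldr (\<otimes>\<^bsub>Phi_T n E\<^esub>) (map (Y_T n E) is) \<one>\<^bsub>Phi_T n E\<^esub> | is.
          set is \<subseteq> {0..n} \<and> length is \<le> k}"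

definition D_ideal :: "nat \<Rightarrow> nat set set \<Rightarrow> (nat, 'k::field) mpoly set" where
  "D_ideal n E =
     Idl\<^bsub>poly_alg {0..n}\<^esub>
       (insert ((\<Prod>i\<in>{0..n}. Var i) - 1)
          {((\<Prod>i\<in>I. Var i) - 1) ^ cut_size E I | I. I \<noteq> {} \<and> I \<subset> {0..n}})"

definition D_T :: "nat \<Rightarrow> nat set set \<Rightarrow> ('k::field, (nat, 'k) mpoly set) module" where
  "D_T n E = quot_alg (poly_alg {0..n}) (D_ideal n E)"

definition D_T_filtration :: "nat \<Rightarrow> nat set set \<Rightarrow> nat \<Rightarrow> (nat, 'k::field) mpoly set set" where
  "D_T_filtration n E k =
     {D_ideal n E +>\<^bsub>poly_alg {0..n}\<^esub> p | p. p \<in> carrier (poly_alg {0..n}) \<and> total_degree_le p k}"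

end

theory Submission
  imports Defs "HOL-Computational_Algebra.Polynomial"
begin

text \<open>
  The isomorphism sends \<open>y\<^sub>i\<close> to \<open>Y\<^sub>i\<close>. It is well defined because
  \<open>\<Prod>\<^sub>i\<^sub>\<in>\<^sub>I Y\<^sub>i\<close> only involves the edges leaving \<open>I\<close>: subtracting 1 and raising to the power
  \<open>D\<^sub>I\<close> leaves a multiple of the product of all these edges, which is not slim.

  For injectivity, \<open>\<phi>\<^sub>e\<^sup>2 = 0\<close> gives \<open>Y\<^sub>i = exp X\<^sub>i\<close> with \<open>X\<^sub>i = \<Sum>\<^sub>e c\<^sub>i\<^sub>e \<phi>\<^sub>e\<close>, while each
  \<open>y\<^sub>i\<close> is unipotent, hence \<open>y\<^sub>i = exp s\<^sub>i\<close>, and \<open>exp s - 1\<close> is a unit times \<open>s\<close>. So it suffices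
  to show that the relations between the \<open>X\<^sub>i\<close> are generated by the powers
  \<open>(\<Sum>\<^sub>i\<^sub>\<in>\<^sub>I x\<^sub>i)\<^bsup>D\<^sub>I\<^esup>\<close>. The coefficient of \<open>\<Prod>\<^sub>e\<^sub>\<in>\<^sub>H \<phi>\<^sub>e\<close> in \<open>f(X)\<close> is \<open>(\<Prod>\<^sub>e\<^sub>\<in>\<^sub>H \<partial>\<^sub>e) f(0)\<close>, where
  \<open>\<partial>\<^sub>e = \<partial>\<^sub>i - \<partial>\<^sub>j\<close> for \<open>e = {i < j}\<close>. Induct by deletion and contraction of an edge \<open>e\<close>:
  if \<open>f\<close> is a relation for \<open>G\<close>, then \<open>\<partial>\<^sub>e f\<close> is one for \<open>G - e\<close>, hence in the span of the powers
  for \<open>G - e\<close>, onto which \<open>\<partial>\<^sub>e\<close> maps the span for \<open>G\<close>; after subtracting a preimage, \<open>\<partial>\<^sub>e f = 0\<close>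
  and \<open>f\<close> is a relation for \<open>G / e\<close>.
\<close>

section \<open>Polynomials\<close>

text \<open>The carrier of \<open>poly_alg V\<close> as a plain set inside the type-class ring of
  all polynomials, so that calculations run on the operations of the type class.\<close>

definition polys :: "'v set \<Rightarrow> ('v, 'k::field) mpoly set" where
  "polys V = {p. \<forall>m \<in> Poly_Mapping.keys p. Poly_Mapping.keys m \<subseteq> V}"

lemma polys_UNIV [simp]: "p \<in> polys UNIV"
  by (simp add: polys_def)

lemma polys_single: "Poly_Mapping.keys m \<subseteq> V \<Longrightarrow> Poly_Mapping.single m c \<in> polys V"
  by (auto simp: polys_def split: if_splits)

lemma polys_zero [simp, intro]: "0 \<in> polys V"
  by (simp add: polys_def)

lemma polys_Const [simp, intro]: "Const c \<in> polys V"
  by (simp add: Const_def polys_single)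

lemma polys_Var [simp, intro]: "v \<in> V \<Longrightarrow> Var v \<in> polys V"
  by (simp add: Var_def polys_single)

lemma polys_add [simp, intro]: "p \<in> polys V \<Longrightarrow> q \<in> polys V \<Longrightarrow> p + q \<in> polys V"
  unfolding polys_def using keys_add[of p q] by blast

lemma polys_mult [simp, intro]:
  assumes "p \<in> polys V" "q \<in> polys V" shows "p * q \<in> polys V"
proof -
  have "Poly_Mapping.keys m \<subseteq> V" if m: "m \<in> Poly_Mapping.keys (p * q)" for m
  proof -
    obtain a b where "a \<in> Poly_Mapping.keys p" "b \<in> Poly_Mapping.keys q" "m = a + b"
      using m keys_mult[of p q] by blast
    then show ?thesis using assms keys_add[of a b] unfolding polys_def by blast
  qed
  then show ?thesis by (simp add: polys_def)
qed

lemma Const_0 [simp]: "Const 0 = 0" and Const_1 [simp]: "Const 1 = 1"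
  by (simp_all add: Const_def)

lemma Const_add: "Const (a + b) = Const a + Const b"
  by (simp add: Const_def single_add)

lemma Const_mult: "Const (a * b) = Const a * Const b"
  by (simp add: Const_def mult_single)

lemma Const_uminus: "Const (- a) = - Const a"
  by (simp add: Const_def single_uminus)

lemma Const_of_nat: "Const (of_nat a) = of_nat a"
  by (simp add: Const_def)

lemma Const_sum: "Const (sum f A) = (\<Sum>x\<in>A. Const (f x))"
  by (induction A rule: infinite_finite_induct) (auto simp: Const_add)

lemma polys_one [simp, intro]: "1 \<in> polys V"
  using polys_Const[of 1] by simp

lemma polys_uminus [simp, intro]: "p \<in> polys V \<Longrightarrow> - p \<in> polys V"
  using polys_mult[OF polys_Const[of "-1"], of p] by (simp add: Const_uminus)

lemma polys_diff [simp, intro]: "p \<in> polys V \<Longrightarrow> q \<in> polys V \<Longrightarrow> p - q \<in> polys V"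
  using polys_add[OF _ polys_uminus, of p V q] by simp

lemma polys_power [simp, intro]: "p \<in> polys V \<Longrightarrow> p ^ k \<in> polys V"
  by (induction k) auto

lemma polys_sum [intro]: "(\<And>x. x \<in> A \<Longrightarrow> f x \<in> polys V) \<Longrightarrow> sum f A \<in> polys V"
  by (induction A rule: infinite_finite_induct) auto

lemma polys_prod [intro]: "(\<And>x. x \<in> A \<Longrightarrow> f x \<in> polys V) \<Longrightarrow> prod f A \<in> polys V"
  by (induction A rule: infinite_finite_induct) auto

lemma mpoly_sum_singles: "p = (\<Sum>m\<in>Poly_Mapping.keys p. Poly_Mapping.single m (Poly_Mapping.lookup p m))"
proof (rule poly_mapping_eqI)
  fix k
  have "(\<Sum>m\<in>Poly_Mapping.keys p. Poly_Mapping.lookup (Poly_Mapping.single m (Poly_Mapping.lookup p m)) k)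
     = (\<Sum>m\<in>Poly_Mapping.keys p. if m = k then Poly_Mapping.lookup p k else 0)"
    by (intro sum.cong) (auto simp: lookup_single when_def)
  also have "\<dots> = Poly_Mapping.lookup p k"
    by (simp add: in_keys_iff)
  finally show "Poly_Mapping.lookup p k = Poly_Mapping.lookup
      (\<Sum>m\<in>Poly_Mapping.keys p. Poly_Mapping.single m (Poly_Mapping.lookup p m)) k"
    by (simp add: lookup_sum)
qed

definition exponent_degree :: "('v \<Rightarrow>\<^sub>0 nat) \<Rightarrow> nat" where
  "exponent_degree m = (\<Sum>v\<in>Poly_Mapping.keys m. Poly_Mapping.lookup m v)"

lemma exponent_degree_add: "exponent_degree (m + m') = exponent_degree m + exponent_degree m'"
proof -
  let ?W = "Poly_Mapping.keys m \<union> Poly_Mapping.keys m'"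
  have "exponent_degree x = (\<Sum>v\<in>?W. Poly_Mapping.lookup x v)" if "x \<in> {m, m', m + m'}" for x
    using that keys_add[of m m'] unfolding exponent_degree_def
    by (intro sum.mono_neutral_left) (auto simp: in_keys_iff)
  then show ?thesis by (simp add: lookup_add sum.distrib)
qed

lemma exponent_degree_single [simp]: "exponent_degree (Poly_Mapping.single v k) = k"
  by (simp add: exponent_degree_def)

lemma exponent_degree_0 [simp]: "exponent_degree 0 = 0"
  by (simp add: exponent_degree_def)

text \<open>Induction on the total degree: a nonzero exponent vector has a variable from which one
  unit can be removed.\<close>

lemma exponent_induct [case_names zero add]:
  fixes m :: "'v \<Rightarrow>\<^sub>0 nat"
  assumes "Q 0"
    and "\<And>m v. Q m \<Longrightarrow> Q (Poly_Mapping.single v 1 + m)"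
  shows "Q m"
proof (induction "exponent_degree m" arbitrary: m)
  case 0
  then have "m = 0"
    by (auto simp: exponent_degree_def sum_eq_0_iff in_keys_iff intro!: poly_mapping_eqI)
  with assms(1) show ?case by simp
next
  case (Suc k)
  then obtain v where v: "v \<in> Poly_Mapping.keys m" by (fastforce simp: exponent_degree_def)
  define m' where "m' = m - Poly_Mapping.single v 1"
  have m: "m = Poly_Mapping.single v 1 + m'"
    using v by (intro poly_mapping_eqI)
      (auto simp: m'_def lookup_add lookup_minus lookup_single when_def in_keys_iff)
  then have "k = exponent_degree m'"
    using Suc(2) exponent_degree_add[of "Poly_Mapping.single v 1" m'] by simp
  then have "Q m'" by (rule Suc(1))
  then show ?case using assms(2) m by metis
qed

lemma single_Suc_exponent:
  "Poly_Mapping.single (Poly_Mapping.single v 1 + m) c = Poly_Mapping.single m c * (Var v :: ('v, 'k::field) mpoly)"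
  by (simp add: Var_def mult_single add.commute)

lemma keys_single_add:
  "Poly_Mapping.keys (Poly_Mapping.single v (1::nat) + m) = insert v (Poly_Mapping.keys m)"
  by (auto simp: in_keys_iff lookup_add lookup_single when_def split: if_splits)

text \<open>Monomials are reached from constants one variable at a time, and a polynomial is the sum
  of its monomials. Nearly all identities for substitutions and derivations below are checked on
  these three constructors.\<close>

lemma polys_induct [consumes 1, case_names Const add mult]:
  fixes p :: "('v, 'k::field) mpoly"
  assumes p: "p \<in> polys V"
    and C: "\<And>c. Q (Const c)"
    and A: "\<And>p q. p \<in> polys V \<Longrightarrow> q \<in> polys V \<Longrightarrow> Q p \<Longrightarrow> Q q \<Longrightarrow> Q (p + q)"
    and M: "\<And>p v. v \<in> V \<Longrightarrow> p \<in> polys V \<Longrightarrow> Q p \<Longrightarrow> Q (p * Var v)"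
  shows "Q p"
proof -
  have S: "Poly_Mapping.keys m \<subseteq> V \<Longrightarrow> Q (Poly_Mapping.single m c)" for m c
  proof (induction m rule: exponent_induct)
    case zero
    then show ?case using C by (simp add: Const_def)
  next
    case (add m v)
    then show ?case unfolding single_Suc_exponent keys_single_add
      by (intro M polys_single) auto
  qed
  have "F \<subseteq> Poly_Mapping.keys p \<Longrightarrow>
     (\<Sum>m\<in>F. Poly_Mapping.single m (Poly_Mapping.lookup p m)) \<in> polys V \<and>
     Q (\<Sum>m\<in>F. Poly_Mapping.single m (Poly_Mapping.lookup p m))" if "finite F" for F
    using that
  proof (induction F rule: finite_induct)
    case empty
    then show ?case using C[of 0] by simp
  next
    case (insert m F)
    then have "Poly_Mapping.keys m \<subseteq> V" using p by (auto simp: polys_def)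
    with insert show ?case by (auto intro!: A S polys_add polys_single)
  qed
  from this[OF finite_keys, of p] mpoly_sum_singles[of p] show ?thesis by simp
qed

lemmas mpoly_induct = polys_induct[OF polys_UNIV, case_names Const add mult]

section \<open>Evaluation homomorphisms from polynomials to commutative rings\<close>

definition monom_eval :: "('v \<Rightarrow> 'r::comm_ring_1) \<Rightarrow> ('v \<Rightarrow>\<^sub>0 nat) \<Rightarrow> 'r" where
  "monom_eval \<rho> m = (\<Prod>v\<in>Poly_Mapping.keys m. \<rho> v ^ Poly_Mapping.lookup m v)"

text \<open>The coefficient map \<kappa> and the target ring are left open: \<kappa> =
  \<open>Const\<close> gives substitution, and coefficients embedded in polynomials in one further
  variable give the Taylor shift behind the derivations.\<close>

definition mpoly_eval :: "('k::field \<Rightarrow> 'r::comm_ring_1) \<Rightarrow> ('v \<Rightarrow> 'r) \<Rightarrow> ('v, 'k) mpoly \<Rightarrow> 'r" where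
  "mpoly_eval \<kappa> \<rho> p = (\<Sum>m\<in>Poly_Mapping.keys p. \<kappa> (Poly_Mapping.lookup p m) * monom_eval \<rho> m)"

lemma monom_eval_superset:
  assumes "finite W" "Poly_Mapping.keys m \<subseteq> W"
  shows "monom_eval \<rho> m = (\<Prod>v\<in>W. \<rho> v ^ Poly_Mapping.lookup m v)"
  unfolding monom_eval_def using assms
  by (intro prod.mono_neutral_left) (auto simp: in_keys_iff)

lemma monom_eval_add: "monom_eval \<rho> (m + m') = monom_eval \<rho> m * monom_eval \<rho> m'"
proof -
  let ?W = "Poly_Mapping.keys m \<union> Poly_Mapping.keys m'"
  have "monom_eval \<rho> x = (\<Prod>v\<in>?W. \<rho> v ^ Poly_Mapping.lookup x v)" if "x \<in> {m, m', m + m'}" for x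
    using that keys_add[of m m'] by (intro monom_eval_superset) auto
  then show ?thesis by (simp add: lookup_add power_add prod.distrib)
qed

locale scalar_hom =
  fixes \<kappa> :: "'k::field \<Rightarrow> 'r::comm_ring_1"
  assumes zero [simp]: "\<kappa> 0 = 0"
    and one [simp]: "\<kappa> 1 = 1"
    and add: "\<kappa> (a + b) = \<kappa> a + \<kappa> b"
    and mult: "\<kappa> (a * b) = \<kappa> a * \<kappa> b"
begin

lemma eval_superset:
  assumes "finite W" "Poly_Mapping.keys p \<subseteq> W"
  shows "mpoly_eval \<kappa> \<rho> p = (\<Sum>m\<in>W. \<kappa> (Poly_Mapping.lookup p m) * monom_eval \<rho> m)"
  unfolding mpoly_eval_def using assms
  by (intro sum.mono_neutral_left) (auto simp: in_keys_iff)

lemma eval_add: "mpoly_eval \<kappa> \<rho> (p + q) = mpoly_eval \<kappa> \<rho> p + mpoly_eval \<kappa> \<rho> q"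
proof -
  let ?W = "Poly_Mapping.keys p \<union> Poly_Mapping.keys q"
  have "mpoly_eval \<kappa> \<rho> x = (\<Sum>m\<in>?W. \<kappa> (Poly_Mapping.lookup x m) * monom_eval \<rho> m)"
    if "x \<in> {p, q, p + q}" for x
    using that keys_add[of p q] by (intro eval_superset) auto
  then show ?thesis by (simp add: lookup_add add distrib_right sum.distrib)
qed

lemma eval_single: "mpoly_eval \<kappa> \<rho> (Poly_Mapping.single m c) = \<kappa> c * monom_eval \<rho> m"
  by (subst eval_superset[of "{m}"]) auto

lemma eval_Const: "mpoly_eval \<kappa> \<rho> (Const c) = \<kappa> c"
  by (simp add: Const_def eval_single monom_eval_def)

lemma eval_Var: "mpoly_eval \<kappa> \<rho> (Var v) = \<rho> v"
  by (simp add: Var_def eval_single monom_eval_def)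

text \<open>First stage of multiplicativity. Constant factors and then arbitrary factors follow by
  induction on the way a polynomial is built.\<close>

lemma eval_mult_Var: "mpoly_eval \<kappa> \<rho> (p * Var v) = mpoly_eval \<kappa> \<rho> p * \<rho> v"
proof -
  have "mpoly_eval \<kappa> \<rho> (Poly_Mapping.single m c * Var v) = mpoly_eval \<kappa> \<rho> (Poly_Mapping.single m c) * \<rho> v" for m c
    by (simp add: Var_def mult_single eval_single monom_eval_add mult.assoc) (simp add: monom_eval_def)
  then have "mpoly_eval \<kappa> \<rho> ((\<Sum>m\<in>F. Poly_Mapping.single m (c m)) * Var v)
    = mpoly_eval \<kappa> \<rho> (\<Sum>m\<in>F. Poly_Mapping.single m (c m)) * \<rho> v" for F c
    by (induction F rule: infinite_finite_induct)
      (simp_all add: distrib_right eval_add, simp_all add: mpoly_eval_def)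
  then show ?thesis by (metis mpoly_sum_singles)
qed

lemma eval_mult_Const: "mpoly_eval \<kappa> \<rho> (p * Const c) = mpoly_eval \<kappa> \<rho> p * \<kappa> c"
proof (induction p rule: mpoly_induct)
  case (Const a)
  show ?case by (simp add: Const_mult[symmetric] eval_Const mult)
next
  case (add p q)
  then show ?case by (simp add: distrib_right eval_add)
next
  case (mult p v)
  have "mpoly_eval \<kappa> \<rho> (p * Var v * Const c) = mpoly_eval \<kappa> \<rho> ((p * Const c) * Var v)"
    by (simp add: mult_ac)
  also have "\<dots> = mpoly_eval \<kappa> \<rho> (p * Var v) * \<kappa> c"
    unfolding eval_mult_Var mult(3) by (simp add: mult_ac)
  finally show ?case .
qed

lemma eval_mult: "mpoly_eval \<kappa> \<rho> (p * q) = mpoly_eval \<kappa> \<rho> p * mpoly_eval \<kappa> \<rho> q"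
proof (induction q rule: mpoly_induct)
  case (Const a)
  show ?case by (simp add: eval_mult_Const eval_Const)
next
  case (add p q)
  then show ?case by (simp add: distrib_left eval_add)
next
  case (mult q v)
  then show ?case by (simp only: eval_mult_Var mult.assoc[symmetric])
qed

end

section \<open>Substitution of polynomials for variables\<close>

definition mpoly_subst :: "('v \<Rightarrow> ('w, 'k::field) mpoly) \<Rightarrow> ('v, 'k) mpoly \<Rightarrow> ('w, 'k) mpoly" where
  "mpoly_subst = mpoly_eval Const"

interpretation subst: scalar_hom Const
  by standard (simp_all add: Const_add Const_mult)

lemma subst_Const [simp]: "mpoly_subst \<rho> (Const c) = Const c"
  and subst_Var [simp]: "mpoly_subst \<rho> (Var v) = \<rho> v"
  and subst_add: "mpoly_subst \<rho> (p + q) = mpoly_subst \<rho> p + mpoly_subst \<rho> q"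
  and subst_mult: "mpoly_subst \<rho> (p * q) = mpoly_subst \<rho> p * mpoly_subst \<rho> q"
  by (simp_all add: mpoly_subst_def subst.eval_Const subst.eval_Var subst.eval_add subst.eval_mult)

lemma subst_0 [simp]: "mpoly_subst \<rho> 0 = 0" and subst_1 [simp]: "mpoly_subst \<rho> 1 = 1"
  using subst_Const[of \<rho> 0] subst_Const[of \<rho> 1] by (simp_all del: subst_Const)

lemma subst_uminus: "mpoly_subst \<rho> (- p) = - mpoly_subst \<rho> p"
  using subst_add[of \<rho> p "-p"] by (simp add: eq_neg_iff_add_eq_0 add.commute)

lemma subst_diff: "mpoly_subst \<rho> (p - q) = mpoly_subst \<rho> p - mpoly_subst \<rho> q"
  using subst_add[of \<rho> p "-q"] by (simp add: subst_uminus)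

lemma subst_power: "mpoly_subst \<rho> (p ^ k) = mpoly_subst \<rho> p ^ k"
  by (induction k) (auto simp: subst_mult)

lemma subst_sum: "mpoly_subst \<rho> (sum f A) = (\<Sum>x\<in>A. mpoly_subst \<rho> (f x))"
  by (induction A rule: infinite_finite_induct) (auto simp: subst_add)

lemma subst_prod: "mpoly_subst \<rho> (prod f A) = (\<Prod>x\<in>A. mpoly_subst \<rho> (f x))"
  by (induction A rule: infinite_finite_induct) (auto simp: subst_mult)

lemmas subst_simps = subst_add subst_mult subst_diff subst_uminus subst_power subst_sum subst_prod

lemma subst_polys:
  assumes "p \<in> polys V" "\<And>v. v \<in> V \<Longrightarrow> \<rho> v \<in> polys W"
  shows "mpoly_subst \<rho> p \<in> polys W"
  using assms(1) by (induction p rule: polys_induct) (auto simp: subst_add subst_mult assms(2))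

lemma subst_subst: "mpoly_subst \<sigma> (mpoly_subst \<rho> p) = mpoly_subst (\<lambda>v. mpoly_subst \<sigma> (\<rho> v)) p"
  by (induction p rule: mpoly_induct) (auto simp: subst_add subst_mult)

lemma subst_id_on:
  assumes "p \<in> polys V" "\<And>v. v \<in> V \<Longrightarrow> \<rho> v = Var v"
  shows "mpoly_subst \<rho> p = p"
  using assms(1) by (induction p rule: polys_induct) (auto simp: subst_add subst_mult assms(2))

section \<open>Derivations\<close>

text \<open>Read off as the linear coefficient in \<open>t\<close> of the Taylor shift \<open>v \<mapsto> v + l v \<cdot> t\<close>,
  which makes the Leibniz rule the product formula for coefficients.\<close>

definition mpoly_deriv :: "('v \<Rightarrow> 'k::field) \<Rightarrow> ('v, 'k) mpoly \<Rightarrow> ('v, 'k) mpoly" where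
  "mpoly_deriv l p = coeff (mpoly_eval (\<lambda>c. [:Const c:]) (\<lambda>v. [:Var v, Const (l v):]) p) 1"

interpretation shift: scalar_hom "\<lambda>c. [:Const c:]"
  by standard (simp_all add: Const_add Const_mult one_pCons)

text \<open>At t = 0 the shift is the identity. This turns the formula for the linear coefficient of
  a product into the Leibniz rule.\<close>

lemma coeff_0_shift: "coeff (mpoly_eval (\<lambda>c. [:Const c:]) (\<lambda>v. [:Var v, Const (l v):]) p) 0 = p"
  by (induction p rule: mpoly_induct)
    (auto simp: shift.eval_Const shift.eval_add shift.eval_mult_Var coeff_mult mult.commute)

lemma deriv_Const [simp]: "mpoly_deriv l (Const c) = 0"
  by (simp add: mpoly_deriv_def shift.eval_Const)

lemma deriv_Var [simp]: "mpoly_deriv l (Var v) = Const (l v)"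
  by (simp add: mpoly_deriv_def shift.eval_Var)

lemma deriv_add: "mpoly_deriv l (p + q) = mpoly_deriv l p + mpoly_deriv l q"
  by (simp add: mpoly_deriv_def shift.eval_add)

lemma deriv_mult: "mpoly_deriv l (p * q) = mpoly_deriv l p * q + p * mpoly_deriv l q"
  using coeff_0_shift[of l]
  by (simp add: mpoly_deriv_def shift.eval_mult coeff_mult)

lemma deriv_0 [simp]: "mpoly_deriv l 0 = 0" and deriv_1 [simp]: "mpoly_deriv l 1 = 0"
  using deriv_Const[of l 0] deriv_Const[of l 1] by (simp_all del: deriv_Const)

lemma deriv_Const_mult [simp]: "mpoly_deriv l (Const c * p) = Const c * mpoly_deriv l p"
  by (simp add: deriv_mult)

lemma deriv_uminus: "mpoly_deriv l (- p) = - mpoly_deriv l p"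
  using deriv_add[of l p "-p"] by (simp add: eq_neg_iff_add_eq_0 add.commute)

lemma deriv_diff: "mpoly_deriv l (p - q) = mpoly_deriv l p - mpoly_deriv l q"
  using deriv_add[of l p "-q"] by (simp add: deriv_uminus)

lemma deriv_sum: "mpoly_deriv l (sum f A) = (\<Sum>x\<in>A. mpoly_deriv l (f x))"
  by (induction A rule: infinite_finite_induct) (auto simp: deriv_add)

lemma deriv_power_Suc: "mpoly_deriv l (p ^ Suc k) = of_nat (Suc k) * p ^ k * mpoly_deriv l p"
  by (induction k) (auto simp: deriv_mult algebra_simps)

lemma deriv_power_eq_0: "mpoly_deriv l p = 0 \<Longrightarrow> mpoly_deriv l (p ^ k) = 0"
  by (cases k) (auto simp: deriv_power_Suc simp del: power_Suc)

lemma deriv_polys: "p \<in> polys V \<Longrightarrow> mpoly_deriv l p \<in> polys V"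
  by (induction p rule: polys_induct) (auto simp: deriv_add deriv_mult)

lemma deriv_linear:
  "mpoly_deriv (\<lambda>v. l v + l' v) p = mpoly_deriv l p + mpoly_deriv l' p"
  by (induction p rule: mpoly_induct) (auto simp: deriv_add deriv_mult Const_add algebra_simps)

lemma deriv_uminus_left: "mpoly_deriv (\<lambda>v. - l v) p = - mpoly_deriv l p"
  by (induction p rule: mpoly_induct) (auto simp: deriv_add deriv_mult Const_uminus algebra_simps)

lemma deriv_zero_left: "mpoly_deriv (\<lambda>v. 0) p = 0"
  by (induction p rule: mpoly_induct) (auto simp: deriv_add deriv_mult)

lemma deriv_cong_on:
  "p \<in> polys V \<Longrightarrow> (\<And>v. v \<in> V \<Longrightarrow> l v = l' v) \<Longrightarrow> mpoly_deriv l p = mpoly_deriv l' p"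
  by (induction p rule: polys_induct) (auto simp: deriv_add deriv_mult)

lemma deriv_commute: "mpoly_deriv l (mpoly_deriv l' p) = mpoly_deriv l' (mpoly_deriv l p)"
  by (induction p rule: mpoly_induct) (auto simp: deriv_add deriv_mult algebra_simps)

text \<open>A derivation with constant values on the variables lowers the degree. Local nilpotency
  makes the repeated integration by parts below terminate.\<close>

lemma deriv_nilpotent: "\<exists>k. (mpoly_deriv l ^^ k) p = 0"
proof (induction p rule: mpoly_induct)
  case (Const c)
  show ?case by (rule exI[of _ 1]) simp
next
  case (add p q)
  then obtain j k where jk: "(mpoly_deriv l ^^ j) p = 0" "(mpoly_deriv l ^^ k) q = 0" by blast
  have fadd: "(mpoly_deriv l ^^ i) (a + b) = (mpoly_deriv l ^^ i) a + (mpoly_deriv l ^^ i) b" for i a b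
    by (induction i) (auto simp: deriv_add)
  have fzero: "(mpoly_deriv l ^^ i) 0 = 0" for i
    by (induction i) auto
  have "(mpoly_deriv l ^^ (k + j)) p = 0" "(mpoly_deriv l ^^ (j + k)) q = 0"
    unfolding funpow_add using jk by (simp_all add: fzero)
  then show ?case by (metis fadd add.commute add_0)
next
  case (mult p v)
  then obtain k where k: "(mpoly_deriv l ^^ k) p = 0" by blast
  \<comment> \<open>The higher Leibniz rule has only two terms here, since the second derivative of
    a variable vanishes.\<close>
  have "(mpoly_deriv l ^^ Suc i) (p * Var v)
      = (mpoly_deriv l ^^ Suc i) p * Var v + of_nat (Suc i) * Const (l v) * (mpoly_deriv l ^^ i) p" for i
  proof (induction i)
    case (Suc i)
    have "(mpoly_deriv l ^^ Suc (Suc i)) (p * Var v) = mpoly_deriv l ((mpoly_deriv l ^^ Suc i) (p * Var v))"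
      by simp
    then show ?case unfolding Suc unfolding Const_of_nat[symmetric] mult.assoc deriv_add deriv_Const_mult
      by (simp add: deriv_mult Const_add Const_def[of "numeral _"] algebra_simps)
  qed (simp add: deriv_mult mult.commute)
  from this[of k] k show ?case by (intro exI[of _ "Suc k"]) simp
qed

section \<open>Coefficients of products with a variable and of partial derivatives\<close>

lemma lookup_mult_Var:
  "Poly_Mapping.lookup (p * Var v) m =
    (if Poly_Mapping.lookup m v = 0 then 0 else Poly_Mapping.lookup p (m - Poly_Mapping.single v 1))"
proof -
  have iff: "m = k + Poly_Mapping.single v 1 \<longleftrightarrow>
      Poly_Mapping.lookup m v \<noteq> 0 \<and> m - Poly_Mapping.single v 1 = k" for k
    by (auto simp: poly_mapping_eq_iff fun_eq_iff lookup_add lookup_minus lookup_single when_def)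
  have single: "Poly_Mapping.lookup (Poly_Mapping.single k c * Var v) m =
    (if Poly_Mapping.lookup m v = 0 then 0
     else Poly_Mapping.lookup (Poly_Mapping.single k c) (m - Poly_Mapping.single v 1))" for k c
    using iff[of k] by (auto simp: Var_def mult_single lookup_single when_def)
  have "Poly_Mapping.lookup ((\<Sum>k\<in>F. Poly_Mapping.single k (c k)) * Var v) m =
    (if Poly_Mapping.lookup m v = 0 then 0
     else Poly_Mapping.lookup (\<Sum>k\<in>F. Poly_Mapping.single k (c k)) (m - Poly_Mapping.single v 1))" for F c
    unfolding sum_distrib_right lookup_sum single by simp
  from this[of "Poly_Mapping.lookup p" "Poly_Mapping.keys p"] show ?thesis
    by (simp only: mpoly_sum_singles[symmetric])
qed

lemma lookup_Const: "Poly_Mapping.lookup (Const c) m = (if m = 0 then c else 0)"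
  by (auto simp: Const_def lookup_single when_def)

lemma lookup_Const_mult: "Poly_Mapping.lookup (Const c * p) m = c * Poly_Mapping.lookup p m"
  unfolding Const_def mult_map_scale_conv_mult[symmetric]
  by (simp add: Poly_Mapping.map.rep_eq when_def)

text \<open>For a coordinate direction the shift-based derivation is the usual partial derivative,
  read off on coefficients.\<close>

lemma lookup_deriv:
  "Poly_Mapping.lookup (mpoly_deriv (\<lambda>w. if w = v then 1 else 0) p) m
    = (of_nat (Poly_Mapping.lookup m v) + 1) * Poly_Mapping.lookup p (m + Poly_Mapping.single v 1)"
proof (induction p arbitrary: m rule: mpoly_induct)
  case (Const c)
  have "m + Poly_Mapping.single v 1 \<noteq> 0"
    by (auto simp: poly_mapping_eq_iff fun_eq_iff lookup_add intro!: exI[of _ v])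
  then show ?case by (simp add: lookup_Const)
next
  case (add p q)
  then show ?case by (simp add: deriv_add lookup_add algebra_simps)
next
  case (mult p w)
  show ?case
  proof (cases "w = v")
    case True
    have "m - Poly_Mapping.single v 1 + Poly_Mapping.single v 1 = m" if "Poly_Mapping.lookup m v \<noteq> 0"
      using that by (intro poly_mapping_eqI) (auto simp: lookup_add lookup_minus lookup_single when_def)
    then have "Poly_Mapping.lookup (mpoly_deriv (\<lambda>w. if w = v then 1 else 0) p * Var v) m
        = of_nat (Poly_Mapping.lookup m v) * Poly_Mapping.lookup p m"
      by (cases "Poly_Mapping.lookup m v")
        (simp_all add: lookup_mult_Var mult(3) lookup_minus flip: One_nat_def)
    then show ?thesis using True
      by (simp add: deriv_mult lookup_add lookup_mult_Var distrib_right)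
  next
    case False
    have "m - Poly_Mapping.single w 1 + Poly_Mapping.single v 1 = m + Poly_Mapping.single v 1 - Poly_Mapping.single w 1"
      using False by (intro poly_mapping_eqI) (auto simp: lookup_add lookup_minus lookup_single when_def)
    then show ?thesis using False
      by (auto simp: deriv_mult lookup_add lookup_mult_Var mult(3) lookup_minus lookup_single when_def)
  qed
qed

text \<open>A monomial containing v contributes to the partial derivative with its exponent as a
  factor, which is nonzero in characteristic zero.\<close>

lemma const_if_derivs_zero:
  fixes p :: "('v, 'k::field_char_0) mpoly"
  assumes p: "p \<in> polys V" and d: "\<And>v. v \<in> V \<Longrightarrow> mpoly_deriv (\<lambda>w. if w = v then 1 else 0) p = 0"
  shows "\<exists>c. p = Const c"
proof -
  have "m = 0" if m: "m \<in> Poly_Mapping.keys p" for m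
  proof (rule ccontr)
    assume "m \<noteq> 0"
    then obtain v where v: "v \<in> Poly_Mapping.keys m"
      by (metis all_not_in_conv keys_eq_empty)
    then have "v \<in> V" using p m by (auto simp: polys_def)
    define k where "k = m - Poly_Mapping.single v 1"
    have k: "k + Poly_Mapping.single v 1 = m" using v
      by (intro poly_mapping_eqI) (auto simp: k_def in_keys_iff lookup_add lookup_minus lookup_single when_def)
    have "(of_nat (Poly_Mapping.lookup k v) + 1) * Poly_Mapping.lookup p m = 0"
      using lookup_deriv[of v p k] d[OF \<open>v \<in> V\<close>] k by simp
    moreover have "of_nat (Poly_Mapping.lookup k v) + 1 \<noteq> (0 :: 'k)"
      by (metis of_nat_Suc of_nat_neq_0 add.commute)
    ultimately show False using m by (simp add: in_keys_iff)
  qed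
  then have "p = Const (Poly_Mapping.lookup p 0)"
    by (intro poly_mapping_eqI) (auto simp: lookup_Const in_keys_iff)
  then show ?thesis ..
qed

section \<open>Ideals and truncated exponentials\<close>

text \<open>Ideals of a type-class ring, carrying a congruence calculus free of carrier
  conditions.\<close>

locale ring_ideal =
  fixes I :: "'r::comm_ring_1 set"
  assumes zero_mem [simp]: "0 \<in> I"
    and add_mem: "a \<in> I \<Longrightarrow> b \<in> I \<Longrightarrow> a + b \<in> I"
    and mult_mem: "a \<in> I \<Longrightarrow> r * a \<in> I"
begin

lemma mult_mem_right: "a \<in> I \<Longrightarrow> a * r \<in> I"
  using mult_mem[of a r] by (simp add: mult.commute)

lemma uminus_mem: "a \<in> I \<Longrightarrow> - a \<in> I"
  using mult_mem[of a "-1"] by simp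

lemma diff_mem: "a \<in> I \<Longrightarrow> b \<in> I \<Longrightarrow> a - b \<in> I"
  using add_mem[OF _ uminus_mem, of a b] by simp

lemma sum_mem: "(\<And>x. x \<in> A \<Longrightarrow> f x \<in> I) \<Longrightarrow> sum f A \<in> I"
  by (induction A rule: infinite_finite_induct) (auto intro: add_mem)

lemma power_mem_mono: "a ^ m \<in> I \<Longrightarrow> m \<le> k \<Longrightarrow> a ^ k \<in> I"
  using mult_mem[of "a ^ m" "a ^ (k - m)"] by (simp add: power_add[symmetric])

definition cong_mod (infix "\<approx>" 50) where "a \<approx> b \<longleftrightarrow> a - b \<in> I"

lemma cong_refl [simp]: "a \<approx> a"
  by (simp add: cong_mod_def)

lemma cong_sym: "a \<approx> b \<Longrightarrow> b \<approx> a"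
  using uminus_mem[of "a - b"] by (simp add: cong_mod_def)

lemma cong_trans [trans]: "a \<approx> b \<Longrightarrow> b \<approx> c \<Longrightarrow> a \<approx> c"
  using add_mem[of "a - b" "b - c"] by (simp add: cong_mod_def)

lemma cong_add: "a \<approx> b \<Longrightarrow> c \<approx> d \<Longrightarrow> a + c \<approx> b + d"
  using add_mem[of "a - b" "c - d"] by (simp add: cong_mod_def algebra_simps)

lemma cong_diff: "a \<approx> b \<Longrightarrow> c \<approx> d \<Longrightarrow> a - c \<approx> b - d"
  using diff_mem[of "a - b" "c - d"] by (simp add: cong_mod_def algebra_simps)

lemma cong_mult: "a \<approx> b \<Longrightarrow> c \<approx> d \<Longrightarrow> a * c \<approx> b * d"
  using add_mem[OF mult_mem[of "a - b" c] mult_mem[of "c - d" b]]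
  by (simp add: cong_mod_def algebra_simps)

lemma cong_power: "a \<approx> b \<Longrightarrow> a ^ k \<approx> b ^ k"
  by (induction k) (auto intro: cong_mult)

lemma cong_sum: "(\<And>x. x \<in> A \<Longrightarrow> f x \<approx> g x) \<Longrightarrow> sum f A \<approx> sum g A"
  by (induction A rule: infinite_finite_induct) (auto intro: cong_add)

lemma cong_prod: "(\<And>x. x \<in> A \<Longrightarrow> f x \<approx> g x) \<Longrightarrow> prod f A \<approx> prod g A"
  by (induction A rule: infinite_finite_induct) (auto intro: cong_mult)

lemma cong_mem: "a \<approx> b \<Longrightarrow> a \<in> I \<longleftrightarrow> b \<in> I"
  using add_mem[of "a - b" b] diff_mem[of a "a - b"] by (auto simp: cong_mod_def)

text \<open>Every term of the binomial expansion contains the A-th power of a or the B-th power of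
  b.\<close>

lemma power_add_mem:
  assumes "a ^ A \<in> I" "b ^ B \<in> I"
  shows "(a + b) ^ (A + B) \<in> I"
  unfolding binomial_ring
proof (rule sum_mem)
  fix k assume "k \<in> {..A + B}"
  then have "A \<le> k \<or> B \<le> A + B - k" by auto
  then show "of_nat (A + B choose k) * a ^ k * b ^ (A + B - k) \<in> I"
    using power_mem_mono[OF assms(1)] power_mem_mono[OF assms(2)]
    by (metis mult.assoc mult_mem mult_mem_right)
qed

text \<open>Modulo the ideal s is nilpotent, so \<open>1 + s * w\<close> is a unit and can be
  cancelled.\<close>

lemma power_mem_of_unipotent_multiple:
  assumes nil: "s ^ B \<in> I" and m: "s ^ m * (1 + s * w) \<in> I"
  shows "s ^ m \<in> I"
proof -
  \<comment> \<open>Instead of inverting the unit, the exponent descends from m + B to m: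
    \<open>s ^ (m + k)\<close> is a multiple of the given element minus a multiple of
    \<open>s ^ (m + k + 1)\<close>.\<close>
  have "s ^ (m + (B - j)) \<in> I" for j
  proof (induction j)
    case 0
    then show ?case using power_mem_mono[OF nil] by simp
  next
    case (Suc j)
    show ?case
    proof (cases "j < B")
      case True
      define k where "k = B - Suc j"
      have k: "B - j = Suc k" using True by (simp add: k_def)
      have "s ^ (m + k) = s ^ k * (s ^ m * (1 + s * w)) - s ^ (m + (B - j)) * w"
        unfolding k by (simp add: algebra_simps power_add)
      then show ?thesis using Suc m diff_mem[OF mult_mem[OF m] mult_mem_right[OF Suc]]
        by (simp add: k_def)
    qed (use Suc in simp)
  qed
  from this[of B] show ?thesis by simp
qed

text \<open>With u the product minus 1, every monomial of u contains some \<open>a e\<close>, so the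
  full product kills u; and a square-free monomial of u to the power \<open>card F\<close> must use
  every factor. Both claims go through one induction because the power claim for a larger set uses
  the annihilation claim for the smaller one.\<close>

lemma prod_one_plus_square_zero:
  assumes "finite F" "\<And>e. e \<in> F \<Longrightarrow> a e ^ 2 \<in> I"
  shows "prod a F * ((\<Prod>e\<in>F. 1 + a e) - 1) \<in> I \<and>
    (\<exists>z. ((\<Prod>e\<in>F. 1 + a e) - 1) ^ card F \<approx> z * prod a F)"
  using assms
proof (induction F rule: finite_induct)
  case empty
  show ?case by (auto intro!: exI[of _ 1])
next
  case (insert e F)
  define u where "u = (\<Prod>e\<in>F. 1 + a e) - 1"
  have P: "(\<Prod>e\<in>F. 1 + a e) = 1 + u" by (simp add: u_def)
  have sq: "a e ^ 2 \<in> I" and sqF: "\<And>e. e \<in> F \<Longrightarrow> a e ^ 2 \<in> I"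
    using insert.prems by auto
  have au: "prod a F * u \<in> I" using insert.IH sqF by (simp add: u_def)
  obtain z where z: "u ^ card F \<approx> z * prod a F" using insert.IH sqF unfolding u_def by blast
  have v: "(\<Prod>e\<in>insert e F. 1 + a e) - 1 = u + a e * (1 + u)"
    using insert(1,2) by (simp add: P algebra_simps)
  show ?case unfolding v
  proof
    have "prod a (insert e F) * (u + a e * (1 + u))
        = a e * (prod a F * u) + prod a F * (1 + u) * a e ^ 2"
      using insert(1,2) by (simp add: algebra_simps power2_eq_square)
    then show "prod a (insert e F) * (u + a e * (1 + u)) \<in> I"
      using au sq by (simp add: add_mem mult_mem)
  next
    let ?k = "card F"
    let ?b = "a e * (1 + u)"
    have b2: "?b ^ 2 \<in> I" using mult_mem[OF sq, of "(1 + u) ^ 2"] by (simp add: power_mult_distrib mult.commute)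
    \<comment> \<open>As b squares to zero, the binomial expansion stops after the linear
      term.\<close>
    have expand: "(u + b) ^ Suc k \<approx> u ^ Suc k + of_nat (Suc k) * (u ^ k * b)" if b: "b ^ 2 \<in> I" for b k
    proof (induction k)
      case (Suc k)
      have "(u + b) ^ Suc (Suc k) \<approx> (u ^ Suc k + of_nat (Suc k) * (u ^ k * b)) * (u + b)"
        using cong_mult[OF Suc cong_refl, of "u + b"] by (simp add: mult.commute)
      also have "\<dots> = u ^ Suc (Suc k) + of_nat (Suc (Suc k)) * (u ^ Suc k * b) + (of_nat (Suc k) * u ^ k) * b ^ 2"
        by (simp add: algebra_simps power2_eq_square)
      also have "\<dots> \<approx> u ^ Suc (Suc k) + of_nat (Suc (Suc k)) * (u ^ Suc k * b)"
        using mult_mem[OF b] by (simp add: cong_mod_def del: of_nat_Suc)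
      finally show ?case .
    qed simp
    have "(u + ?b) ^ Suc ?k \<approx> u * u ^ ?k + of_nat (Suc ?k) * (u ^ ?k * ?b)"
      using expand[OF b2] by simp
    also have "\<dots> \<approx> u * (z * prod a F) + of_nat (Suc ?k) * ((z * prod a F) * ?b)"
      by (intro cong_add cong_mult cong_refl z)
    also have "\<dots> = z * (prod a F * u) + (of_nat (Suc ?k) * z * (1 + u)) * (a e * prod a F)"
      by (simp add: algebra_simps)
    also have "\<dots> \<approx> (of_nat (Suc ?k) * z * (1 + u)) * (a e * prod a F)"
      using mult_mem[OF au] by (simp add: cong_mod_def)
    finally show "\<exists>z. (u + ?b) ^ card (insert e F) \<approx> z * prod a (insert e F)"
      using insert(1,2) by (auto simp del: of_nat_Suc)
  qed
qed

end

text \<open>The exponential series cut off after degree N. The exponential laws hold for it modulo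
  ideals in which the arguments are nilpotent of order small against N.\<close>

definition texp :: "nat \<Rightarrow> ('v, 'k::field_char_0) mpoly \<Rightarrow> ('v, 'k) mpoly" where
  "texp N t = (\<Sum>k\<le>N. Const (1 / fact k) * t ^ k)"

lemma subst_texp: "mpoly_subst \<rho> (texp N t) = texp N (mpoly_subst \<rho> t)"
  by (simp add: texp_def subst_simps)

lemma texp_polys: "t \<in> polys V \<Longrightarrow> texp N t \<in> polys V"
  by (auto simp: texp_def intro!: polys_sum)

lemma texp_0 [simp]: "texp N 0 = 1"
  by (induction N) (auto simp: texp_def)

lemma texp_split:
  assumes "N \<ge> 1"
  shows "texp N t = 1 + t + (\<Sum>k\<in>{2..N}. Const (1 / fact k) * t ^ k)"
proof -
  have "{..N} = {0, 1} \<union> {2..N}" using assms by auto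
  then show ?thesis unfolding texp_def
    by (subst sum.union_disjoint[symmetric, of "{0,1}", simplified] | simp)+
qed

text \<open>Shows that the exponential minus 1 is t times \<open>1 + t * w\<close>, which is a unit
  wherever t is nilpotent.\<close>

lemma texp_quadratic:
  assumes "N \<ge> 1"
  obtains w where "texp N t = 1 + t + t ^ 2 * w"
proof
  show "texp N t = 1 + t + t ^ 2 * (\<Sum>k\<in>{2..N}. Const (1 / fact k) * t ^ (k - 2))"
    unfolding texp_split[OF assms] sum_distrib_left
  proof (intro arg_cong2[where f = "(+)"] refl sum.cong)
    fix k assume "k \<in> {2..N}"
    then have "t ^ k = t ^ 2 * t ^ (k - 2)" 
      by (metis atLeastAtMost_iff le_add_diff_inverse power_add)
    then show "Const (1 / fact k) * t ^ k = t ^ 2 * (Const (1 / fact k) * t ^ (k - 2))"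
      by (simp add: mult.left_commute)
  qed
qed

text \<open>One step of successive approximation: a change d of the argument changes the value by d
  up to one further power of t. For exponents j at least 2 the difference of j-th powers is d times
  a sum in which each term contains s or \<open>s + d\<close>, both divisible by t.\<close>

lemma texp_shift_dvd:
  assumes N: "N \<ge> 1" and s: "t dvd s" and d: "t ^ Suc k dvd d"
  shows "t ^ Suc (Suc k) dvd texp N (s + d) - texp N s - d"
proof -
  have "texp N (s + d) - texp N s - d = (\<Sum>j\<in>{2..N}. Const (1 / fact j) * ((s + d) ^ j - s ^ j))"
    by (simp add: texp_split[OF N] sum_subtractf algebra_simps)
  moreover have "t ^ Suc (Suc k) dvd (s + d) ^ j - s ^ j" if "j \<ge> 2" for j
  proof -
    have sd: "t dvd s + d" using s d by (metis dvd_add dvd_mult_left power_Suc)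
    have "t dvd s ^ (j - Suc i) * (s + d) ^ i" if "i < j" for i
    proof (cases "i = 0")
      case True
      then have "j - Suc i \<noteq> 0" using \<open>j \<ge> 2\<close> by simp
      then have "t dvd s ^ (j - Suc i)" using s by (metis dvd_power dvd_trans not_gr_zero)
      then show ?thesis by simp
    next
      case False
      then have "t dvd (s + d) ^ i" using sd by (metis dvd_power dvd_trans not_gr_zero)
      then show ?thesis by simp
    qed
    then have "t dvd (\<Sum>i<j. s ^ (j - Suc i) * (s + d) ^ i)"
      by (intro dvd_sum) auto
    with d have "t ^ Suc k * t dvd d * (\<Sum>i<j. s ^ (j - Suc i) * (s + d) ^ i)"
      by (rule mult_dvd_mono)
    then show ?thesis
      using power_diff_sumr2[of "s + d" j s] by (simp add: mult_ac)
  qed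
  ultimately show ?thesis by (auto intro!: dvd_sum)
qed

text \<open>A logarithm to any prescribed order, by successive approximation.\<close>

lemma texp_surj:
  assumes "N \<ge> 1"
  shows "\<exists>s. t dvd s \<and> t ^ Suc k dvd texp N s - (1 + t)"
proof (induction k)
  case 0
  show ?case by (rule exI[of _ 0]) simp
next
  case (Suc k)
  then obtain s where s: "t dvd s" "t ^ Suc k dvd texp N s - (1 + t)" by blast
  \<comment> \<open>The correction is minus the current error.\<close>
  define d where "d = - (texp N s - (1 + t))"
  have d: "t ^ Suc k dvd d" using s(2) unfolding d_def by (simp only: dvd_minus_iff)
  have "texp N (s + d) - (1 + t) = texp N (s + d) - texp N s - d"
    by (simp add: d_def)
  moreover have "t dvd s + d" using s d by (metis dvd_add dvd_mult_left power_Suc)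
  ultimately show ?case using texp_shift_dvd[OF assms s(1) d] by metis
qed

section \<open>Exponentials and logarithms modulo an ideal\<close>

locale mpoly_ideal = ring_ideal I for I :: "('v, 'k::field_char_0) mpoly set"
begin

lemma texp_cong: "a \<approx> b \<Longrightarrow> texp N a \<approx> texp N b"
  unfolding texp_def by (intro cong_sum cong_mult cong_power cong_refl)

text \<open>The terms of degree at most N agree by the binomial theorem. A remaining term of the
  product has i + j > N, hence i at least A or j at least B, and lies in the ideal.\<close>

lemma texp_add:
  assumes "a ^ A \<in> I" "b ^ B \<in> I" "A + B \<le> Suc N"
  shows "texp N a * texp N b \<approx> texp N (a + b)"
proof -
  define g where "g i j = Const (1 / fact i) * Const (1 / fact j) * (a ^ i * b ^ j)" for i j
  have bin: "Const (1 / fact k) * (of_nat (k choose i) * a ^ i * b ^ (k - i)) = g i (k - i)"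
    if "i \<le> k" for i k
  proof -
    have "1 / fact k * of_nat (k choose i) = 1 / fact i * (1 / fact (k - i) :: 'k)"
      using binomial_fact[OF that, where 'a = 'k] by simp
    then have "Const (1 / fact k) * of_nat (k choose i) = Const (1 / fact i) * (Const (1 / fact (k - i)) :: ('v, 'k) mpoly)"
      unfolding Const_of_nat[symmetric] Const_mult[symmetric] by simp
    then show ?thesis unfolding g_def by (simp add: mult.assoc[symmetric])
  qed
  have "texp N (a + b) = (\<Sum>k\<le>N. \<Sum>i\<le>k. g i (k - i))"
    unfolding texp_def binomial_ring sum_distrib_left
    by (intro sum.cong refl bin) simp
  also have "\<dots> = (\<Sum>(i,j)\<in>{(i,j). i + j \<le> N}. g i j)"
    by (rule sum.triangle_reindex_eq[symmetric])
  finally have 1: "texp N (a + b) = (\<Sum>(i,j)\<in>{(i,j). i + j \<le> N}. g i j)" .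
  have "texp N a * texp N b = (\<Sum>(i,j)\<in>{..N} \<times> {..N}. g i j)"
    unfolding texp_def sum_product sum.cartesian_product[symmetric] g_def
    by (intro sum.cong refl) (simp add: mult_ac)
  also have "\<dots> = (\<Sum>(i,j)\<in>({..N} \<times> {..N}) - {(i,j). i + j \<le> N}. g i j) + (\<Sum>(i,j)\<in>{(i,j). i + j \<le> N}. g i j)"
    by (rule sum.subset_diff) auto
  finally have "texp N a * texp N b - texp N (a + b)
      = (\<Sum>(i,j)\<in>({..N} \<times> {..N}) - {(i,j). i + j \<le> N}. g i j)" using 1 by simp
  also have "\<dots> \<in> I"
  proof (rule sum_mem)
    fix x assume "x \<in> ({..N} \<times> {..N}) - {(i,j). i + j \<le> N}"
    then obtain i j where x: "x = (i, j)" and "\<not> i + j \<le> N" by auto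
    then have "A \<le> i \<or> B \<le> j" using assms(3) by linarith
    then have "a ^ i \<in> I \<or> b ^ j \<in> I"
      using power_mem_mono[OF assms(1)] power_mem_mono[OF assms(2)] by blast
    then show "(case x of (i, j) \<Rightarrow> g i j) \<in> I" unfolding x g_def
      by (auto intro: mult_mem mult_mem_right)
  qed
  finally show ?thesis by (simp add: cong_mod_def)
qed

text \<open>Nilpotency of the partial sum is carried along because adding the next summand by
  \<open>texp_add\<close> requires it. The exponent is a successor so that the empty sum, 0, also
  satisfies the bound.\<close>

lemma texp_sum:
  assumes "finite F" "\<And>i. i \<in> F \<Longrightarrow> a i ^ A \<in> I" "card F * A \<le> N"
  shows "sum a F ^ Suc (card F * A) \<in> I \<and> (\<Prod>i\<in>F. texp N (a i)) \<approx> texp N (sum a F)"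
  using assms
proof (induction F rule: finite_induct)
  case (insert i F)
  have nil: "sum a F ^ Suc (card F * A) \<in> I" and IH: "(\<Prod>i\<in>F. texp N (a i)) \<approx> texp N (sum a F)"
    using insert.IH insert.prems insert.hyps by auto
  have ai: "a i ^ A \<in> I" using insert.prems by simp
  show ?case
  proof
    show "sum a (insert i F) ^ Suc (card (insert i F) * A) \<in> I" using power_add_mem[OF ai nil] insert(1,2) by (simp add: add.commute)
  next
    have "texp N (a i) * (\<Prod>i\<in>F. texp N (a i)) \<approx> texp N (a i) * texp N (sum a F)"
      by (intro cong_mult IH cong_refl)
    also have "\<dots> \<approx> texp N (a i + sum a F)"
      by (rule texp_add[OF ai nil]) (use insert in simp)
    finally show "(\<Prod>i\<in>insert i F. texp N (a i)) \<approx> texp N (sum a (insert i F))"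
      using insert(1,2) by simp
  qed
qed simp_all

text \<open>\<open>texp N s - 1\<close> is s times a unipotent factor, so its m-th power and that of
  s lie in the ideal together. The exponent m is preserved exactly, which is what carries cut sizes
  from the multiplicative to the additive relations.\<close>

lemma power_mem_of_texp:
  assumes N: "N \<ge> 1" and nil: "s ^ B \<in> I" and u: "texp N s \<approx> u" and um: "(u - 1) ^ m \<in> I"
  shows "s ^ m \<in> I"
proof -
  obtain w where w: "texp N s = 1 + s + s ^ 2 * w" using texp_quadratic[OF N] by blast
  have "(texp N s - 1) ^ m \<in> I"
    using cong_mem[OF cong_power[OF cong_diff[OF u cong_refl]]] um by blast
  also have "texp N s - 1 = s * (1 + s * w)" by (simp add: w power2_eq_square algebra_simps)
  finally have 1: "s ^ m * (1 + s * w) ^ m \<in> I" by (simp add: power_mult_distrib)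
  have "\<exists>w'. (1 + s * w) ^ m = 1 + s * w'"
  proof (induction m)
    case (Suc m)
    then obtain w' where "(1 + s * w) ^ m = 1 + s * w'" by blast
    then have "(1 + s * w) ^ Suc m = 1 + s * (w + w' + s * w * w')" by (simp add: algebra_simps)
    then show ?case by blast
  qed (auto intro: exI[of _ 0])
  with 1 show ?thesis using power_mem_of_unipotent_multiple[OF nil] by metis
qed

text \<open>The approximate logarithm of y is divisible by \<open>y - 1\<close> and so inherits its
  order of nilpotency; the error of the approximation is already in the ideal.\<close>

lemma texp_log:
  assumes "N \<ge> 1" "(y - 1) ^ Suc k \<in> I"
  obtains s where "s ^ Suc k \<in> I" "texp N s \<approx> y"
proof -
  obtain s where s: "y - 1 dvd s" "(y - 1) ^ Suc k dvd texp N s - (1 + (y - 1))"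
    using texp_surj[OF assms(1)] by blast
  have "(y - 1) ^ Suc k dvd s ^ Suc k" by (rule dvd_power_same[OF s(1)])
  then have "s ^ Suc k \<in> I" using assms(2) by (auto elim!: dvdE simp: mult_mem_right)
  moreover have "texp N s \<approx> y"
    using s(2) assms(2) unfolding cong_mod_def by (auto elim!: dvdE simp: mult_mem_right)
  ultimately show thesis by (rule that)
qed

lemma texp_square_zero:
  assumes "N \<ge> 1" "t ^ 2 \<in> I"
  shows "texp N t \<approx> 1 + t"
proof -
  obtain w where "texp N t = 1 + t + t ^ 2 * w" using texp_quadratic[OF assms(1)] by blast
  then show ?thesis using mult_mem_right[OF assms(2)] by (simp add: cong_mod_def)
qed

text \<open>Coefficients of a square-zero element add up under multiplication. Applied to one edge,
  the incidences at the vertices of a set sum to \<open>cut_sign\<close>.\<close>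

lemma prod_one_plus_multiples:
  assumes "t ^ 2 \<in> I"
  shows "(\<Prod>i\<in>A. 1 + Const (c i) * t) \<approx> 1 + Const (sum c A) * t"
proof (induction A rule: infinite_finite_induct)
  case (insert i A)
  have "(\<Prod>i\<in>insert i A. 1 + Const (c i) * t) = (1 + Const (c i) * t) * (\<Prod>i\<in>A. 1 + Const (c i) * t)"
    using insert by simp
  also have "\<dots> \<approx> (1 + Const (c i) * t) * (1 + Const (sum c A) * t)"
    by (intro cong_mult insert cong_refl)
  also have "\<dots> = 1 + Const (sum c (insert i A)) * t + Const (c i) * Const (sum c A) * t ^ 2"
    using insert by (simp add: Const_add algebra_simps power2_eq_square)
  also have "\<dots> \<approx> 1 + Const (sum c (insert i A)) * t"
    using mult_mem[OF assms] by (simp add: cong_mod_def)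
  finally show ?case .
qed simp_all

lemma subst_cong:
  assumes "p \<in> polys V" "\<And>v. v \<in> V \<Longrightarrow> \<rho> v \<approx> \<sigma> v"
  shows "mpoly_subst \<rho> p \<approx> mpoly_subst \<sigma> p"
  using assms(1) by (induction p rule: polys_induct)
    (auto simp: subst_add subst_mult intro: cong_add cong_mult assms(2))

end

section \<open>Cuts, contraction and deletion\<close>

lemma simple_graph_edge:
  assumes "simple_graph n E" "e \<in> E"
  obtains u v where "e = {u, v}" "u < v" "v \<le> n"
proof -
  have e: "e \<subseteq> {0..n}" "card e = 2" using assms by (auto simp: simple_graph_def)
  then obtain u v where "e = {u, v}" "u \<noteq> v" by (auto simp: card_2_iff)
  then show thesis using e(1) that[of u v] that[of v u]
    by (cases "u < v") (auto simp: insert_commute)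
qed

lemma simple_graph_finite: "simple_graph n E \<Longrightarrow> finite E"
  by (rule finite_subset[of _ "Pow {0..n}"]) (auto simp: simple_graph_def)

lemma simple_graph_mono: "simple_graph n E \<Longrightarrow> E' \<subseteq> E \<Longrightarrow> simple_graph n E'"
  by (auto simp: simple_graph_def)

lemma incidence_edge:
  assumes "u < v"
  shows "incidence i {u, v} = (if i = u then 1 else 0) - (if i = v then 1 else (0 :: 'k::field))"
proof -
  have "(\<exists>j. {u, v} = {i, j} \<and> i < j) \<longleftrightarrow> i = u" "(\<exists>j. {u, v} = {i, j} \<and> i > j) \<longleftrightarrow> i = v"
    using assms by (auto simp: doubleton_eq_iff)
  then show ?thesis using assms by (auto simp: incidence_def)
qed

text \<open>The coefficient of \<open>phi_e\<close> in the sum of the \<open>X_i\<close> over I: up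
  to sign 1 if e leaves I, and 0 otherwise.\<close>

definition cut_sign :: "nat set \<Rightarrow> nat set \<Rightarrow> 'k::field" where
  "cut_sign I e = (\<Sum>i\<in>I. incidence i e)"

lemma cut_sign_edge:
  assumes "u < v" "finite I"
  shows "cut_sign I {u, v} = (if u \<in> I then 1 else 0) - (if v \<in> I then 1 else (0 :: 'k::field))"
  using assms by (simp add: cut_sign_def incidence_edge sum_subtractf)

lemma card_edge_inter:
  assumes "u \<noteq> v"
  shows "card ({u, v} \<inter> I) = 1 \<longleftrightarrow> (u \<in> I) \<noteq> (v \<in> I)"
  using assms by (auto simp: Int_insert_left)

lemma cut_sign_eq_0_iff:
  assumes "simple_graph n E" "e \<in> E" "finite I"
  shows "cut_sign I e = (0 :: 'k::field) \<longleftrightarrow> card (e \<inter> I) \<noteq> 1"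
proof -
  obtain u v where "e = {u, v}" "u < v" using simple_graph_edge[OF assms(1,2)] .
  then show ?thesis using cut_sign_edge[of u v I] card_edge_inter[of u v I] assms(3) by auto
qed

abbreviation adj :: "nat set set \<Rightarrow> (nat \<times> nat) set" where
  "adj E \<equiv> {(x, y). {x, y} \<in> E}"

lemma adj_rtrancl_sym:
  assumes "(u, v) \<in> (adj E)\<^sup>*"
  shows "(v, u) \<in> (adj E)\<^sup>*"
proof -
  have "sym (adj E)" by (rule symI) (simp add: insert_commute)
  from symD[OF sym_rtrancl[OF this] assms] show ?thesis .
qed

lemma adj_rtrancl_same_side:
  assumes "(u, v) \<in> (adj C)\<^sup>*" "simple_graph n C" "\<And>c. c \<in> C \<Longrightarrow> card (c \<inter> I) \<noteq> 1"
  shows "u \<in> I \<longleftrightarrow> v \<in> I"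
  using assms(1)
proof (induction rule: rtrancl_induct)
  case (step y z)
  then have "{y, z} \<in> C" by simp
  then have "y \<noteq> z" "card ({y, z} \<inter> I) \<noteq> 1"
    using assms(2,3) by (auto simp: simple_graph_def)
  then show ?case using step.IH card_edge_inter[of y z I] by simp
qed simp

text \<open>For a simple graph C these are the nonempty unions of components of C that miss vertex
  0, that is, the cuts of the contracted graph, each represented by its side without 0. This fits
  the elimination of the variable of vertex 0.\<close>

definition cuts :: "nat \<Rightarrow> nat set set \<Rightarrow> nat set set" where
  "cuts n C = {I. I \<noteq> {} \<and> I \<subseteq> {1..n} \<and> (\<forall>c\<in>C. card (c \<inter> I) \<noteq> 1)}"

text \<open>The components of u and v are disjoint, so at least one of them misses vertex 0 and
  serves as the cut.\<close>

lemma separating_cut: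
  assumes C: "simple_graph n C" and uv: "u \<le> n" "v \<le> n" "(u, v) \<notin> (adj C)\<^sup>*"
  obtains I where "I \<in> cuts n C" "(u \<in> I) \<noteq> (v \<in> I)"
proof -
  define comp where "comp w = {x. (w, x) \<in> (adj C)\<^sup>*}" for w
  have comp: "comp w \<in> cuts n C" if "w \<le> n" "0 \<notin> comp w" for w
  proof -
    have "x \<le> n" if "(w, x) \<in> (adj C)\<^sup>*" for x
      using that
    proof (induction rule: rtrancl_induct)
      case (step y z)
      then show ?case using C by (auto simp: simple_graph_def)
    qed (fact \<open>w \<le> n\<close>)
    then have "comp w \<subseteq> {1..n}"
      using \<open>0 \<notin> comp w\<close> by (auto simp: comp_def Suc_le_eq intro!: Nat.gr0I)
    moreover have "w \<in> comp w" by (simp add: comp_def)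
    moreover have "card (c \<inter> comp w) \<noteq> 1" if c: "c \<in> C" for c
    proof -
      obtain a b where ab: "c = {a, b}" "a < b" using simple_graph_edge[OF C c] .
      then have "(a, b) \<in> adj C" "(b, a) \<in> adj C" using c by (simp_all add: insert_commute)
      then have "a \<in> comp w \<longleftrightarrow> b \<in> comp w"
        unfolding comp_def by (metis (no_types, lifting) mem_Collect_eq rtrancl.rtrancl_into_rtrancl)
      then show ?thesis using card_edge_inter[of a b] ab by blast
    qed
    ultimately show ?thesis unfolding cuts_def by blast
  qed
  have u: "u \<in> comp u" "v \<notin> comp u" using uv by (auto simp: comp_def)
  have v: "v \<in> comp v" "u \<notin> comp v" using uv adj_rtrancl_sym by (auto simp: comp_def)
  show thesis
  proof (cases "0 \<in> comp u")
    case True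
    have "0 \<notin> comp v"
      using True uv(3) adj_rtrancl_sym[of v 0 C] rtrancl_trans[of u 0 "adj C" v]
      unfolding comp_def by blast
    then show thesis using that[OF comp[OF uv(2)]] v by blast
  next
    case False
    then show thesis using that[OF comp[OF uv(1)]] u by blast
  qed
qed

lemma connected_graph_mono:
  assumes "connected_graph n E" "E \<subseteq> E'"
  shows "connected_graph n E'"
proof -
  have "adj E \<subseteq> adj E'" using assms(2) by auto
  then show ?thesis using assms(1) rtrancl_mono unfolding connected_graph_def by blast
qed

lemma crossing_edge:
  assumes "connected_graph n C" "simple_graph n C" "i \<in> I" "i \<le> n" "j \<notin> I" "j \<le> n"
  shows "\<exists>c\<in>C. card (c \<inter> I) = 1"
  using adj_rtrancl_same_side[of i j C n I] assms unfolding connected_graph_def by auto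

section \<open>Edge derivatives and polynomials on the contracted graph\<close>

definition edge_deriv :: "nat set \<Rightarrow> (nat, 'k::field) mpoly \<Rightarrow> (nat, 'k) mpoly" where
  "edge_deriv e = mpoly_deriv (\<lambda>i. incidence i e)"

definition cut_form :: "nat set \<Rightarrow> (nat, 'k::field) mpoly" where
  "cut_form I = (\<Sum>i\<in>I. Var i)"

lemma edge_deriv_cut_form: "edge_deriv e (cut_form I) = Const (cut_sign I e)"
  by (simp add: edge_deriv_def cut_form_def cut_sign_def deriv_sum Const_sum)

text \<open>Polynomials in \<open>x\<^sub>1, \<dots>, x\<^sub>n\<close> (the variable of vertex 0 being eliminated through
  \<open>x\<^sub>0 = - (x\<^sub>1 + \<dots> + x\<^sub>n)\<close>) that descend to the contraction of \<open>C\<close>.\<close>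

definition contracted_polys :: "nat \<Rightarrow> nat set set \<Rightarrow> (nat, 'k::field) mpoly set" where
  "contracted_polys n C = {f \<in> polys {1..n}. \<forall>c\<in>C. edge_deriv c f = 0}"

lemma contracted_add: "f \<in> contracted_polys n C \<Longrightarrow> g \<in> contracted_polys n C \<Longrightarrow> f + g \<in> contracted_polys n C"
  by (auto simp: contracted_polys_def edge_deriv_def deriv_add)

lemma contracted_diff: "f \<in> contracted_polys n C \<Longrightarrow> g \<in> contracted_polys n C \<Longrightarrow> f - g \<in> contracted_polys n C"
  by (auto simp: contracted_polys_def edge_deriv_def deriv_diff)

lemma contracted_mult: "f \<in> contracted_polys n C \<Longrightarrow> g \<in> contracted_polys n C \<Longrightarrow> f * g \<in> contracted_polys n C"
  by (auto simp: contracted_polys_def edge_deriv_def deriv_mult)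

lemma contracted_Const: "Const c \<in> contracted_polys n C"
  by (auto simp: contracted_polys_def edge_deriv_def)

lemma contracted_zero: "0 \<in> contracted_polys n C"
  using contracted_Const[of 0] by simp

lemma contracted_power: "f \<in> contracted_polys n C \<Longrightarrow> f ^ k \<in> contracted_polys n C"
  using contracted_Const[of 1] by (induction k) (auto intro: contracted_mult)

lemma contracted_edge_deriv: "f \<in> contracted_polys n C \<Longrightarrow> edge_deriv e f \<in> contracted_polys n C"
  by (auto simp: contracted_polys_def edge_deriv_def deriv_polys deriv_commute[of _ "\<lambda>i. incidence i e"])

lemma contracted_cut_form:
  assumes "simple_graph n C" "I \<in> cuts n C"
  shows "(cut_form I :: (nat, 'k::field) mpoly) \<in> contracted_polys n C"
proof -
  have "finite I" using assms(2) by (auto simp: cuts_def intro: finite_subset)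
  then have "cut_sign I c = (0 :: 'k)" if "c \<in> C" for c
    using that assms cut_sign_eq_0_iff[OF assms(1) that] by (auto simp: cuts_def)
  moreover have "(cut_form I :: (nat, 'k) mpoly) \<in> polys {1..n}"
    using assms(2) by (auto simp: cut_form_def cuts_def intro!: polys_sum)
  ultimately show ?thesis by (auto simp: contracted_polys_def edge_deriv_cut_form)
qed

text \<open>The differences of partial derivatives telescope along a path in C.\<close>

lemma edge_deriv_path:
  assumes "simple_graph n C" "(u, v) \<in> (adj C)\<^sup>*" "f \<in> contracted_polys n C"
  shows "mpoly_deriv (\<lambda>i. (if i = u then 1 else 0) - (if i = v then 1 else 0)) f = 0"
  using assms(2)
proof (induction rule: rtrancl_induct)
  case base
  show ?case by (simp add: deriv_zero_left)
next
  case (step y z)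
  define d where "d a b = mpoly_deriv (\<lambda>i. (if i = a then 1 else 0) - (if i = b then 1 else 0)) f" for a b
  have yz: "{y, z} \<in> C" "{z, y} \<in> C" using step(2) by (simp_all add: insert_commute)
  have d_less: "d a b = 0" if "a < b" "{a, b} \<in> C" for a b
  proof -
    have "d a b = edge_deriv {a, b} f"
      unfolding d_def edge_deriv_def incidence_edge[OF that(1)] ..
    then show ?thesis using that(2) assms(3) by (simp add: contracted_polys_def)
  qed
  \<comment> \<open>Antisymmetry covers an edge traversed from its larger to its smaller endpoint,
    since \<open>edge_deriv\<close> fixes the orientation.\<close>
  have "d y z = - d z y"
    unfolding d_def deriv_uminus_left[symmetric] by simp
  moreover have "y \<noteq> z" using yz assms(1) by (auto simp: simple_graph_def)
  ultimately have "d y z = 0" using d_less yz by (metis linorder_neq_iff minus_zero)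
  moreover have "d u z = d u y + d y z"
    unfolding d_def by (subst deriv_linear[symmetric]) simp
  ultimately show ?case using step(3) by (simp add: d_def)
qed

text \<open>The element \<open>h\<close> is a slice for the locally nilpotent derivation; integrate by parts.\<close>

lemma edge_deriv_integrate:
  fixes h :: "(nat, 'k::field_char_0) mpoly"
  assumes h: "h \<in> contracted_polys n C" "edge_deriv e h = Const b" "b \<noteq> 0"
    and p: "p \<in> contracted_polys n C"
  shows "\<exists>g \<in> contracted_polys n C. edge_deriv e (h ^ Suc m * g) = h ^ m * p"
proof -
  obtain k where "(edge_deriv e ^^ k) p = 0" using deriv_nilpotent unfolding edge_deriv_def by blast
  then show ?thesis using p
  proof (induction k arbitrary: p m)
    case 0
    then show ?case by (intro bexI[of _ 0]) (auto simp: edge_deriv_def contracted_zero)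
  next
    case (Suc k)
    have "(edge_deriv e ^^ k) (edge_deriv e p) = 0"
      using Suc.prems(1) by (simp add: funpow_Suc_right del: funpow.simps)
    from Suc.IH[OF this contracted_edge_deriv[OF Suc.prems(2)], of "Suc m"]
    obtain g1 where g1: "g1 \<in> contracted_polys n C"
      "edge_deriv e (h ^ Suc (Suc m) * g1) = h ^ Suc m * edge_deriv e p" by blast
    \<comment> \<open>The factor a cancels \<open>of_nat (Suc m) * b\<close>, which comes from
      differentiating \<open>h ^ Suc m\<close>; the term \<open>h * g1\<close> in g removes the
      remainder \<open>h ^ Suc m * edge_deriv e p\<close>.\<close>
    define a where "a = 1 / (of_nat (Suc m) * b)"
    define g where "g = Const a * (p - h * g1)"
    have a: "Const a * (of_nat (Suc m) * Const b) = (1 :: (nat, 'k) mpoly)"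
      using h(3) unfolding Const_of_nat[symmetric] Const_mult[symmetric] a_def
      by (simp del: of_nat_Suc)
    have "edge_deriv e (h ^ Suc m * g)
        = Const a * edge_deriv e (h ^ Suc m * p - h ^ Suc (Suc m) * g1)"
      unfolding edge_deriv_def deriv_Const_mult[symmetric] by (simp add: g_def algebra_simps)
    also have "\<dots> = Const a * (edge_deriv e (h ^ Suc m * p) - h ^ Suc m * edge_deriv e p)"
      using g1(2) by (simp add: edge_deriv_def deriv_diff)
    also have "edge_deriv e (h ^ Suc m * p)
        = of_nat (Suc m) * h ^ m * Const b * p + h ^ Suc m * edge_deriv e p"
      using h(2) unfolding edge_deriv_def deriv_mult deriv_power_Suc by simp
    also have "Const a * (of_nat (Suc m) * h ^ m * Const b * p + h ^ Suc m * edge_deriv e p - h ^ Suc m * edge_deriv e p)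
        = (Const a * (of_nat (Suc m) * Const b)) * (h ^ m * p)"
      by (simp only: add_diff_cancel_right' mult_ac)
    also have "\<dots> = h ^ m * p" by (simp only: a mult_1)
    finally show ?case
      using g1(1) Suc.prems(2) h(1)
      by (intro bexI[of _ g]) (auto simp: g_def intro!: contracted_mult contracted_diff contracted_Const)
  qed
qed

text \<open>The ideal of \<open>contracted_polys n C\<close> generated by the cut powers of the
  graph with edges \<open>C \<union> E\<close> in which C is contracted. Building its elements one
  multiple at a time allows lifting them generator by generator.\<close>

inductive_set cut_power_span :: "nat \<Rightarrow> nat set set \<Rightarrow> nat set set \<Rightarrow> (nat, 'k::field) mpoly set"
  for n C E where
  zero: "0 \<in> cut_power_span n C E"
| step: "p \<in> contracted_polys n C \<Longrightarrow> I \<in> cuts n C \<Longrightarrow> g \<in> cut_power_span n C E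
    \<Longrightarrow> p * cut_form I ^ cut_size E I + g \<in> cut_power_span n C E"

lemma cut_power_span_add:
  assumes "f \<in> cut_power_span n C E" "g \<in> cut_power_span n C E"
  shows "f + g \<in> cut_power_span n C E"
  using assms(1) by induction (auto simp: add.assoc intro: cut_power_span.step assms(2))

lemma cut_power_span_gen:
  assumes "p \<in> contracted_polys n C" "I \<in> cuts n C"
  shows "p * cut_form I ^ cut_size E I \<in> cut_power_span n C E"
  using cut_power_span.step[OF assms cut_power_span.zero] by simp

lemma cut_power_span_contracted:
  assumes "simple_graph n C" "f \<in> cut_power_span n C E"
  shows "f \<in> contracted_polys n C"
  using assms(2)
  by induction (auto intro!: contracted_add contracted_mult contracted_power contracted_zero
      contracted_cut_form assms(1))

lemma cut_size_insert:
  assumes "finite E" "e \<notin> E"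
  shows "cut_size (insert e E) I = (if card (e \<inter> I) = 1 then Suc (cut_size E I) else cut_size E I)"
proof -
  have "{x \<in> insert e E. card (x \<inter> I) = 1} =
     (if card (e \<inter> I) = 1 then insert e {x \<in> E. card (x \<inter> I) = 1} else {x \<in> E. card (x \<inter> I) = 1})"
    by auto
  then show ?thesis using assms by (simp add: cut_size_def)
qed

text \<open>Each multiple of a generator is integrated separately. If e crosses I, adding e raises
  the exponent by one, and \<open>cut_form I\<close> itself serves as slice. If not, the derivative
  kills \<open>cut_form I\<close>, and only the cofactor p has to be integrated.\<close>

lemma edge_deriv_lift:
  fixes f :: "(nat, 'k::field_char_0) mpoly"
  assumes G: "simple_graph n (C \<union> insert e E)" and e: "e = {u, v}" "u < v" "v \<le> n" "e \<notin> E"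
    and uv: "(u, v) \<notin> (adj C)\<^sup>*" and f: "f \<in> cut_power_span n C E"
  shows "\<exists>g \<in> cut_power_span n C (insert e E). edge_deriv e g = f"
  using f
proof induction
  case zero
  then show ?case by (intro bexI[of _ 0]) (auto simp: edge_deriv_def cut_power_span.zero)
next
  case (step p I g)
  have C: "simple_graph n C" and E: "finite E"
    using simple_graph_mono[OF G, of C] simple_graph_finite[OF G] by auto
  have eC: "simple_graph n {e}" using simple_graph_mono[OF G, of "{e}"] by auto
  have fin: "finite I" if "I \<in> cuts n C" for I
    using that by (auto simp: cuts_def intro: finite_subset)
  obtain g' where g': "g' \<in> cut_power_span n C (insert e E)" "edge_deriv e g' = g"
    using step by blast
  let ?m = "cut_size E I"
  have "\<exists>q \<in> contracted_polys n C.
    edge_deriv e (q * cut_form I ^ cut_size (insert e E) I) = p * cut_form I ^ ?m"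
  proof (cases "card (e \<inter> I) = 1")
    case True
    have "cut_sign I e \<noteq> (0::'k)"
      using cut_sign_eq_0_iff[OF eC, of e I] fin[OF step(2)] True by auto
    from edge_deriv_integrate[OF contracted_cut_form[OF C step(2)] edge_deriv_cut_form this step(1), of ?m]
    show ?thesis using True cut_size_insert[OF E e(4)] by (simp add: mult.commute)
  next
    case False
    \<comment> \<open>The slice for integrating p is the form of a cut separating the ends of e,
      which exists because C does not connect them.\<close>
    obtain J where J: "J \<in> cuts n C" "(u \<in> J) \<noteq> (v \<in> J)"
      using separating_cut[OF C _ _ uv] e by auto
    then have "cut_sign J e \<noteq> (0::'k)"
      using cut_sign_edge[OF e(2) fin[OF J(1)], where 'k = 'k] e(1) by auto
    from edge_deriv_integrate[OF contracted_cut_form[OF C J(1)] edge_deriv_cut_form this step(1), of 0]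
    obtain q where q: "q \<in> contracted_polys n C" "edge_deriv e (cut_form J * q) = p" by auto
    have "cut_sign I e = (0::'k)"
      using cut_sign_eq_0_iff[OF eC, of e I] fin[OF step(2)] False by auto
    then have "edge_deriv e (cut_form I ^ ?m :: (nat, 'k) mpoly) = 0"
      unfolding edge_deriv_def
      by (intro deriv_power_eq_0) (simp add: edge_deriv_cut_form[unfolded edge_deriv_def])
    then have "edge_deriv e (cut_form J * q * cut_form I ^ ?m) = p * cut_form I ^ ?m"
      using q(2) unfolding edge_deriv_def by (subst deriv_mult) simp
    then show ?thesis using False cut_size_insert[OF E e(4)] q(1) contracted_cut_form[OF C J(1)]
      by (intro bexI[of _ "cut_form J * q"]) (auto intro: contracted_mult)
  qed
  then obtain q where q: "q \<in> contracted_polys n C"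
    "edge_deriv e (q * cut_form I ^ cut_size (insert e E) I) = p * cut_form I ^ ?m" by blast
  show ?case
    using cut_power_span.step[OF q(1) step(2) g'(1)] q(2) g'(2)
    by (intro bexI[of _ "q * cut_form I ^ cut_size (insert e E) I + g'"])
      (auto simp: edge_deriv_def deriv_add)
qed

section \<open>Coefficients at square-free edge monomials\<close>

definition edge_monom :: "nat set set \<Rightarrow> (nat set \<Rightarrow>\<^sub>0 nat)" where
  "edge_monom H = (\<Sum>e\<in>H. Poly_Mapping.single e 1)"

lemma lookup_edge_monom: "finite H \<Longrightarrow> Poly_Mapping.lookup (edge_monom H) e = (if e \<in> H then 1 else 0)"
  by (simp add: edge_monom_def lookup_sum lookup_single when_def)

text \<open>The polynomial representing \<open>X_i\<close>.\<close>

definition edge_subst :: "nat set set \<Rightarrow> nat \<Rightarrow> (nat set, 'k::field) mpoly" where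
  "edge_subst E i = (\<Sum>e\<in>E. Const (incidence i e) * Var e)"

definition edge_coeff :: "nat set set \<Rightarrow> nat set set \<Rightarrow> (nat, 'k::field) mpoly \<Rightarrow> 'k" where
  "edge_coeff E H f = Poly_Mapping.lookup (mpoly_subst (edge_subst E) f) (edge_monom H)"

lemma lookup_edge_monom_mult_Var:
  assumes "finite H"
  shows "Poly_Mapping.lookup (p * Var e) (edge_monom H) =
    (if e \<in> H then Poly_Mapping.lookup p (edge_monom (H - {e})) else 0)"
proof -
  have "edge_monom H - Poly_Mapping.single e 1 = edge_monom (H - {e})" if "e \<in> H"
    using assms that by (intro poly_mapping_eqI)
      (auto simp: lookup_minus lookup_edge_monom lookup_single when_def)
  then show ?thesis using assms by (auto simp: lookup_mult_Var lookup_edge_monom)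
qed

lemma edge_coeff_add: "edge_coeff E H (f + g) = edge_coeff E H f + edge_coeff E H g"
  by (simp add: edge_coeff_def subst_add lookup_add)

lemma edge_coeff_diff: "edge_coeff E H (f - g) = edge_coeff E H f - edge_coeff E H g"
  by (simp add: edge_coeff_def subst_diff lookup_minus)

lemma edge_coeff_Const_mult: "edge_coeff E H (Const c * f) = c * edge_coeff E H f"
  by (simp add: edge_coeff_def subst_mult lookup_Const_mult)

lemma edge_coeff_Const:
  assumes "finite H"
  shows "edge_coeff E H (Const c) = (if H = {} then c else 0)"
proof -
  have "edge_monom H = 0 \<longleftrightarrow> H = {}"
    using assms by (auto simp: poly_mapping_eq_iff fun_eq_iff lookup_edge_monom)
  then show ?thesis by (simp add: edge_coeff_def lookup_Const)
qed

text \<open>In a product with \<open>X_i\<close>, the monomial of H arises by choosing the edge of H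
  contributed by \<open>X_i\<close>; since the monomial is square-free, the other factor supplies
  the remaining edges.\<close>

lemma edge_coeff_mult_Var:
  assumes "finite E" "H \<subseteq> E"
  shows "edge_coeff E H (f * Var i) = (\<Sum>e\<in>H. incidence i e * edge_coeff E (H - {e}) f)"
proof -
  have H: "finite H" using assms finite_subset by blast
  have "edge_coeff E H (f * Var i)
      = (\<Sum>e\<in>E. Poly_Mapping.lookup (Const (incidence i e) * (mpoly_subst (edge_subst E) f * Var e)) (edge_monom H))"
    unfolding edge_coeff_def lookup_sum[symmetric]
    by (simp add: subst_mult edge_subst_def[of E i] sum_distrib_left mult_ac)
  also have "\<dots> = (\<Sum>e\<in>E. if e \<in> H then incidence i e * edge_coeff E (H - {e}) f else 0)"
    unfolding lookup_Const_mult lookup_edge_monom_mult_Var[OF H] edge_coeff_def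
    by (intro sum.cong) auto
  also have "\<dots> = (\<Sum>e\<in>H. incidence i e * edge_coeff E (H - {e}) f)"
    using assms by (simp add: sum.inter_restrict[symmetric] Int_absorb1)
  finally show ?thesis .
qed

lemma edge_coeff_mult_cut_form:
  assumes "finite E" "H \<subseteq> E" "finite I"
  shows "edge_coeff E H (f * cut_form I) = (\<Sum>e\<in>H. cut_sign I e * edge_coeff E (H - {e}) f :: 'k::field)"
proof -
  have "edge_coeff E H (\<Sum>i\<in>I. g i) = (\<Sum>i\<in>I. edge_coeff E H (g i))"
    for g :: "nat \<Rightarrow> (nat, 'k) mpoly"
    by (simp add: edge_coeff_def subst_sum lookup_sum)
  then show ?thesis
    unfolding cut_form_def sum_distrib_left cut_sign_def sum_distrib_right
    by (subst sum.swap) (simp add: edge_coeff_mult_Var[OF assms(1,2)])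
qed

text \<open>Both sides satisfy the same recursion under multiplication by a variable: choosing e
  itself corresponds to the Leibniz term that differentiates the variable.\<close>

lemma edge_coeff_edge_deriv:
  assumes "finite E" "insert e H \<subseteq> E" "e \<notin> H"
  shows "edge_coeff E H (edge_deriv e f) = edge_coeff E (insert e H) f"
  using assms(2,3)
proof (induction f arbitrary: H rule: mpoly_induct)
  case (Const c)
  then have "finite H" using assms(1) finite_subset by auto
  then show ?case using edge_coeff_Const[of H E 0] by (simp add: edge_deriv_def edge_coeff_Const)
next
  case (add p q)
  then show ?case by (simp add: edge_deriv_def deriv_add edge_coeff_add)
next
  case (mult p i)
  have H: "finite H" "H \<subseteq> E" using assms(1) mult(4) finite_subset by auto
  have IH: "edge_coeff E (H - {e'}) (edge_deriv e p) = edge_coeff E (insert e H - {e'}) p" if "e' \<in> H" for e'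
  proof -
    have "insert e H - {e'} = insert e (H - {e'})" using that mult(5) by auto
    then show ?thesis using mult(3)[of "H - {e'}"] mult(4,5) by auto
  qed
  have "edge_coeff E (insert e H) (p * Var i)
      = incidence i e * edge_coeff E H p + (\<Sum>e'\<in>H. incidence i e' * edge_coeff E (insert e H - {e'}) p)"
    unfolding edge_coeff_mult_Var[OF assms(1) mult(4)] using mult(5) H by simp
  also have "\<dots> = edge_coeff E H (Const (incidence i e) * p) + edge_coeff E H (edge_deriv e p * Var i)"
    unfolding edge_coeff_mult_Var[OF assms(1) H(2)] edge_coeff_Const_mult using IH by simp
  also have "\<dots> = edge_coeff E H (edge_deriv e (p * Var i))"
    by (simp add: edge_coeff_add[symmetric] edge_deriv_def deriv_mult algebra_simps)
  finally show ?case ..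
qed

text \<open>Pigeonhole: the m factors \<open>cut_form I\<close> must contribute m different edges of
  H with nonzero sign.\<close>

lemma edge_coeff_cut_power_eq_0:
  assumes "finite E" "H \<subseteq> E" "finite I" "card {e \<in> H. cut_sign I e \<noteq> (0::'k)} < m"
  shows "edge_coeff E H (p * cut_form I ^ m) = (0 :: 'k::field)"
  using assms(2,4)
proof (induction m arbitrary: H)
  case (Suc m)
  have H: "finite H" using assms(1) Suc.prems(1) finite_subset by blast
  have 0: "cut_sign I e * edge_coeff E (H - {e}) (p * cut_form I ^ m) = 0" if e: "e \<in> H" for e
  proof (cases "cut_sign I e = (0::'k)")
    case False
    have "{x \<in> H - {e}. cut_sign I x \<noteq> (0::'k)} = {x \<in> H. cut_sign I x \<noteq> (0::'k)} - {e}" by auto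
    then have "card {x \<in> H - {e}. cut_sign I x \<noteq> (0::'k)} < m"
      using Suc.prems(2) H e False card_Diff1_less[of "{x \<in> H. cut_sign I x \<noteq> (0::'k)}" e] by simp
    then show ?thesis using Suc.IH[of "H - {e}"] Suc.prems(1) by auto
  qed simp
  have "p * cut_form I ^ Suc m = (p * cut_form I ^ m) * cut_form I" by (simp add: mult_ac)
  then show ?case
    by (simp only: edge_coeff_mult_cut_form[OF assms(1) Suc.prems(1) assms(3)])
      (rule sum.neutral, use 0 in blast)
qed simp

text \<open>The converse of the theorem below: cut powers are relations. If removing H leaves the
  graph connected, some edge leaving I lies outside H, so H contains fewer than
  \<open>cut_size E I\<close> edges leaving I.\<close>

lemma edge_coeff_cut_power_span:
  assumes G: "simple_graph n (C \<union> E)" and F: "E \<subseteq> F" "finite F"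
    and H: "H \<subseteq> E" "connected_graph n (C \<union> (E - H))"
    and f: "f \<in> cut_power_span n C E"
  shows "edge_coeff F H f = (0 :: 'k::field)"
  using f
proof induction
  case zero
  then show ?case by (simp add: edge_coeff_def)
next
  case (step p I g)
  have I: "I \<noteq> {}" "I \<subseteq> {1..n}" "finite I" using step(2) by (auto simp: cuts_def intro: finite_subset)
  have E: "finite E" using F finite_subset by blast
  obtain i where i: "i \<in> I" "i \<le> n" "0 \<notin> I" using I by fastforce
  obtain e where e: "e \<in> C \<union> (E - H)" "card (e \<inter> I) = 1"
    using crossing_edge[OF H(2) simple_graph_mono[OF G] i(1,2) i(3)] by auto
  \<comment> \<open>The crossing edge cannot belong to C, because I is a cut of the
    contraction.\<close>
  then have eE: "e \<in> E - H" using step(2) by (auto simp: cuts_def)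
  have "{x \<in> H. cut_sign I x \<noteq> (0::'k)} \<subseteq> {x \<in> E. card (x \<inter> I) = 1} - {e}"
    using H(1) eE cut_sign_eq_0_iff[OF simple_graph_mono[OF G, of E] _ I(3), where 'k = 'k] by auto
  then have "card {x \<in> H. cut_sign I x \<noteq> (0::'k)} \<le> card ({x \<in> E. card (x \<inter> I) = 1} - {e})"
    using E by (intro card_mono) auto
  also have "\<dots> < cut_size E I"
    unfolding cut_size_def using E e(2) eE by (intro psubset_card_mono) auto
  finally have "edge_coeff F H (p * cut_form I ^ cut_size E I) = 0"
    using edge_coeff_cut_power_eq_0[OF F(2) _ I(3)] F(1) H(1) by blast
  then show ?case using step by (simp add: edge_coeff_add)
qed

text \<open>\<open>C\<close> collects the contracted edges, so that contraction never leaves the original graph.\<close>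

theorem annihilator_cut_power_span:
  fixes f :: "(nat, 'k::field_char_0) mpoly"
  assumes "finite F" "finite E" "E \<subseteq> F" "simple_graph n (C \<union> E)" "C \<inter> E = {}"
    and "f \<in> contracted_polys n C"
    and "\<And>H. H \<subseteq> E \<Longrightarrow> connected_graph n (C \<union> (E - H)) \<Longrightarrow> edge_coeff F H f = 0"
  shows "f \<in> cut_power_span n C E"
  using assms(2-)
proof (induction E arbitrary: C f rule: finite_induct)
  case empty
  have C: "simple_graph n C" using empty by simp
  show ?case
  proof (cases "connected_graph n C")
    case True
    have f: "f \<in> polys {1..n}" using empty.prems by (simp add: contracted_polys_def)
    have "mpoly_deriv (\<lambda>w. if w = v then 1 else 0) f = 0" if v: "v \<in> {1..n}" for v
    proof -
      have "(v, 0) \<in> (adj C)\<^sup>*" using True v by (auto simp: connected_graph_def)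
      from edge_deriv_path[OF C this empty.prems(4)]
      have "mpoly_deriv (\<lambda>i. (if i = v then 1 else 0) - (if i = 0 then 1 else 0)) f = 0" .
      also have "mpoly_deriv (\<lambda>i. (if i = v then 1 else 0) - (if i = 0 then 1 else 0)) f
          = mpoly_deriv (\<lambda>w. if w = v then 1 else 0) f"
        by (rule deriv_cong_on[OF f]) auto
      finally show ?thesis .
    qed
    then obtain c where c: "f = Const c" using const_if_derivs_zero[OF f] by blast
    \<comment> \<open>The coefficient at the empty edge set is the constant term.\<close>
    have "edge_coeff F {} f = 0" using empty.prems(5)[of "{}"] True by simp
    then have "f = 0" using c by (simp add: edge_coeff_Const)
    then show ?thesis by (simp add: cut_power_span.zero)
  next
    case False
    then obtain u v where "u \<le> n" "v \<le> n" "(u, v) \<notin> (adj C)\<^sup>*" by (auto simp: connected_graph_def)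
    then obtain I where I: "I \<in> cuts n C" using separating_cut[OF C] by metis
    \<comment> \<open>With no edges left the cut has exponent 0, so its power is 1 and the span is
      everything.\<close>
    have "cut_size {} I = 0" by (simp add: cut_size_def)
    then show ?thesis using cut_power_span_gen[OF empty.prems(4) I, of "{}"] by simp
  qed
next
  case (insert e E)
  note G = insert.prems(2)
  have C: "simple_graph n C" using simple_graph_mono[OF G, of C] by auto
  obtain u v where e: "e = {u, v}" "u < v" "v \<le> n" using simple_graph_edge[OF G, of e] by auto
  have eC: "e \<notin> C" using insert.prems(3) by auto
  show ?case
  proof (cases "(u, v) \<in> (adj C)\<^sup>*")
    case True
    \<comment> \<open>Here e is a loop of the contracted graph: it affects neither connectivity nor
      any cut size, and is simply deleted.\<close>
    have "edge_coeff F H f = 0" if H: "H \<subseteq> E" "connected_graph n (C \<union> (E - H))" for H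
      using H insert.prems(5)[of H] connected_graph_mono[OF H(2), of "C \<union> (insert e E - H)"] by auto
    then have f: "f \<in> cut_power_span n C E"
      using insert.prems(1,3,4) simple_graph_mono[OF G, of "C \<union> E"] by (intro insert.IH) auto
    have size: "cut_size (insert e E) I = cut_size E I" if "I \<in> cuts n C" for I
    proof -
      have "card (e \<inter> I) \<noteq> 1"
        using adj_rtrancl_same_side[OF True C, of I] that card_edge_inter[of u v I] e(1,2)
        by (auto simp: cuts_def)
      then show ?thesis using cut_size_insert[OF insert.hyps(1,2)] by simp
    qed
    have "g \<in> cut_power_span n C (insert e E)" if "g \<in> cut_power_span n C E" for g :: "(nat, 'k) mpoly"
      using that
    proof induction
      case (step p I g)
      then show ?case using cut_power_span.step[of p n C I g "insert e E"] size by simp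
    qed (rule cut_power_span.zero)
    then show ?thesis using f by blast
  next
    case False
    \<comment> \<open>Deletion: the coefficient of the derivative at H is that of f at
      \<open>insert e H\<close>, and removing \<open>insert e H\<close> from the graph is the same
      as removing H after deleting e.\<close>
    have "edge_coeff F H (edge_deriv e f) = 0" if H: "H \<subseteq> E" "connected_graph n (C \<union> (E - H))" for H
    proof -
      have "insert e E - insert e H = E - H" using insert.hyps(2) by auto
      then have "edge_coeff F (insert e H) f = 0"
        using insert.prems(5)[of "insert e H"] H by auto
      moreover have "insert e H \<subseteq> F" "e \<notin> H" using H(1) insert.prems(1) insert.hyps(2) by auto
      ultimately show ?thesis using edge_coeff_edge_deriv[OF assms(1)] by metis
    qed
    then have "edge_deriv e f \<in> cut_power_span n C E"
      using insert.prems(1,3,4) simple_graph_mono[OF G, of "C \<union> E"]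
      by (intro insert.IH contracted_edge_deriv) auto
    then obtain g where g: "g \<in> cut_power_span n C (insert e E)" "edge_deriv e g = edge_deriv e f"
      using edge_deriv_lift[OF G e insert.hyps(2) False] by blast
    have "f - g \<in> contracted_polys n C"
      using insert.prems(4) cut_power_span_contracted[OF C g(1)] by (rule contracted_diff)
    \<comment> \<open>Contraction: after subtracting the lift, the derivative along e vanishes, so e
      can move into the contracted set.\<close>
    then have fg: "f - g \<in> contracted_polys n (insert e C)"
      using g(2) by (auto simp: contracted_polys_def edge_deriv_def deriv_diff)
    have "edge_coeff F H (f - g) = 0" if H: "H \<subseteq> E" "connected_graph n (insert e C \<union> (E - H))" for H
    proof -
      have eq: "insert e C \<union> (E - H) = C \<union> (insert e E - H)" using H(1) insert.hyps(2) by auto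
      have "edge_coeff F H f = 0" using insert.prems(5)[of H] H unfolding eq by auto
      moreover have "edge_coeff F H g = 0"
        using edge_coeff_cut_power_span[OF G insert.prems(1) assms(1) _ _ g(1), of H] H unfolding eq by auto
      ultimately show ?thesis by (simp add: edge_coeff_diff)
    qed
    then have "f - g \<in> cut_power_span n (insert e C) E"
      using insert.prems(1,3) G fg insert.hyps(2) by (intro insert.IH) auto
    \<comment> \<open>A cut of \<open>insert e C\<close> is not crossed by e, so its exponent is the
      same with or without e in the edge set.\<close>
    moreover have "r \<in> cut_power_span n C (insert e E)" if "r \<in> cut_power_span n (insert e C) E" for r :: "(nat, 'k) mpoly"
      using that
    proof induction
      case (step p I r)
      have "cut_size (insert e E) I = cut_size E I" "I \<in> cuts n C" "p \<in> contracted_polys n C"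
        using step(1,2) cut_size_insert[OF insert.hyps(1,2)] by (auto simp: cuts_def contracted_polys_def)
      then show ?case using cut_power_span.step[of p n C I r "insert e E"] step by simp
    qed (rule cut_power_span.zero)
    ultimately have "f - g + g \<in> cut_power_span n C (insert e E)"
      using g(1) by (intro cut_power_span_add) auto
    then show ?thesis by simp
  qed
qed

section \<open>The defining ideals\<close>

lemma poly_alg_sel [simp]:
  "carrier (poly_alg V) = polys V" "a \<oplus>\<^bsub>poly_alg V\<^esub> b = a + b" "a \<otimes>\<^bsub>poly_alg V\<^esub> b = a * b"
  "\<zero>\<^bsub>poly_alg V\<^esub> = 0" "\<one>\<^bsub>poly_alg V\<^esub> = 1" "c \<odot>\<^bsub>poly_alg V\<^esub> a = Const c * a"
  by (simp_all add: poly_alg_def polys_def)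

lemma poly_alg_cring: "cring (poly_alg V)"
proof (rule cringI)
  show "abelian_group (poly_alg V)"
  proof (rule abelian_groupI)
    fix x assume "x \<in> carrier (poly_alg V)"
    then show "\<exists>y\<in>carrier (poly_alg V). y \<oplus>\<^bsub>poly_alg V\<^esub> x = \<zero>\<^bsub>poly_alg V\<^esub>"
      by (intro bexI[of _ "- x"]) auto
  qed (auto simp: add_ac)
  show "comm_monoid (poly_alg V)"
    by (rule comm_monoidI) (auto simp: mult_ac)
qed (auto simp: algebra_simps)

text \<open>Restates ideals of the record in type-class terms; negatives come from multiplication by
  -1.\<close>

lemma poly_alg_ideal_iff:
  "ideal I (poly_alg V) \<longleftrightarrow> I \<subseteq> polys V \<and> 0 \<in> I \<and> (\<forall>a\<in>I. \<forall>b\<in>I. a + b \<in> I)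
     \<and> (\<forall>a\<in>I. \<forall>r\<in>polys V. r * a \<in> I)"
proof
  assume "ideal I (poly_alg V)"
  then interpret ideal I "poly_alg V" .
  show "I \<subseteq> polys V \<and> 0 \<in> I \<and> (\<forall>a\<in>I. \<forall>b\<in>I. a + b \<in> I) \<and> (\<forall>a\<in>I. \<forall>r\<in>polys V. r * a \<in> I)"
    using a_subset I_l_closed additive_subgroup.zero_closed[OF additive_subgroup_axioms]
      additive_subgroup.a_closed[OF additive_subgroup_axioms] by auto
next
  assume I: "I \<subseteq> polys V \<and> 0 \<in> I \<and> (\<forall>a\<in>I. \<forall>b\<in>I. a + b \<in> I) \<and> (\<forall>a\<in>I. \<forall>r\<in>polys V. r * a \<in> I)"
  interpret cring "poly_alg V" by (rule poly_alg_cring)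
  have um: "- a \<in> I" if "a \<in> I" for a
    using I that polys_uminus[OF polys_one, of V] by (metis mult_minus1)
  have inv: "\<ominus>\<^bsub>poly_alg V\<^esub> a = - a" if "a \<in> polys V" for a
    using that by (intro minus_equality) auto
  then have minus: "\<ominus>\<^bsub>poly_alg V\<^esub> a \<in> I" if "a \<in> I" for a using um[OF that] I that inv[of a] by auto
  show "ideal I (poly_alg V)"
  proof (rule idealI)
    show "ring (poly_alg V)" by (rule ring_axioms)
    show "subgroup I (add_monoid (poly_alg V))"
      using I minus by (intro add.subgroupI) (auto simp flip: a_inv_def)
  qed (use I in \<open>auto simp: mult.commute\<close>)
qed

definition var_restrict :: "'v set \<Rightarrow> ('v, 'k::field) mpoly \<Rightarrow> ('v, 'k) mpoly" where
  "var_restrict V = mpoly_subst (\<lambda>v. if v \<in> V then Var v else 0)"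

lemma var_restrict_polys: "var_restrict V p \<in> polys V"
  unfolding var_restrict_def by (rule subst_polys[of _ UNIV]) auto

lemma var_restrict_id: "p \<in> polys V \<Longrightarrow> var_restrict V p = p"
  unfolding var_restrict_def by (rule subst_id_on) auto

text \<open>Pulling ideals back to the ring in all variables removes carrier conditions from
  congruence computations.\<close>

lemma var_restrict_vimage_ideal:
  fixes I :: "('v, 'k::field_char_0) mpoly set"
  assumes "ideal I (poly_alg V)"
  shows "mpoly_ideal (var_restrict V -` I)"
proof -
  have pol: "var_restrict V p \<in> polys V" for p :: "('v, 'k) mpoly" by (rule var_restrict_polys)
  show ?thesis
    using assms pol unfolding poly_alg_ideal_iff
    by unfold_locales (auto simp: var_restrict_def subst_add subst_mult)
qed

lemma var_restrict_vimage_iff: "p \<in> polys V \<Longrightarrow> p \<in> var_restrict V -` I \<longleftrightarrow> p \<in> I"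
  by (simp add: var_restrict_id)

lemma Idl_poly_alg:
  assumes "S \<subseteq> polys V"
  shows "ideal (Idl\<^bsub>poly_alg V\<^esub> S) (poly_alg V)" "S \<subseteq> Idl\<^bsub>poly_alg V\<^esub> S"
    "\<And>J. ideal J (poly_alg V) \<Longrightarrow> S \<subseteq> J \<Longrightarrow> Idl\<^bsub>poly_alg V\<^esub> S \<subseteq> J"
proof -
  interpret cring "poly_alg V" by (rule poly_alg_cring)
  show "ideal (Idl\<^bsub>poly_alg V\<^esub> S) (poly_alg V)" using assms by (simp add: genideal_ideal)
  show "S \<subseteq> Idl\<^bsub>poly_alg V\<^esub> S" using assms by (simp add: genideal_self)
  show "\<And>J. ideal J (poly_alg V) \<Longrightarrow> S \<subseteq> J \<Longrightarrow> Idl\<^bsub>poly_alg V\<^esub> S \<subseteq> J"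
    by (rule genideal_minimal)
qed

lemma Phi_gens_polys:
  "{(Var e)\<^sup>2 | e. e \<in> E} \<union> {\<Prod>e\<in>H. Var e | H. H \<subseteq> E \<and> \<not> slim n E H} \<subseteq> (polys E :: (nat set, 'k::field) mpoly set)"
  by (auto intro!: polys_prod)

lemma D_gens_polys:
  "insert ((\<Prod>i\<in>{0..n}. Var i) - 1)
     {((\<Prod>i\<in>I. Var i) - 1) ^ cut_size E I | I. I \<noteq> {} \<and> I \<subset> {0..n}} \<subseteq> (polys {0..n} :: (nat, 'k::field) mpoly set)"
proof -
  have "(\<Prod>i\<in>I. Var i) \<in> (polys {0..n} :: (nat, 'k) mpoly set)" if "I \<subseteq> {0..n}" for I
    using that by (intro polys_prod) auto
  then show ?thesis by (auto simp: psubset_eq)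
qed

lemma Phi_ideal_ideal: "ideal (Phi_ideal n E :: (nat set, 'k::field) mpoly set) (poly_alg E)"
  unfolding Phi_ideal_def by (rule Idl_poly_alg(1)[OF Phi_gens_polys])

lemma D_ideal_ideal: "ideal (D_ideal n E :: (nat, 'k::field) mpoly set) (poly_alg {0..n})"
  unfolding D_ideal_def by (rule Idl_poly_alg(1)[OF D_gens_polys])

lemma Phi_ideal_square: "e \<in> E \<Longrightarrow> ((Var e)\<^sup>2 :: (nat set, 'k::field) mpoly) \<in> Phi_ideal n E"
  using Idl_poly_alg(2)[OF Phi_gens_polys, folded Phi_ideal_def] by blast

lemma Phi_ideal_not_slim: "H \<subseteq> E \<Longrightarrow> \<not> slim n E H \<Longrightarrow> (\<Prod>e\<in>H. Var e) \<in> Phi_ideal n E"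
  using Idl_poly_alg(2)[OF Phi_gens_polys, folded Phi_ideal_def] by blast

lemma D_ideal_full: "(\<Prod>i\<in>{0..n}. Var i) - 1 \<in> D_ideal n E"
  using Idl_poly_alg(2)[OF D_gens_polys, folded D_ideal_def] by blast

lemma D_ideal_cut: "I \<noteq> {} \<Longrightarrow> I \<subset> {0..n} \<Longrightarrow> ((\<Prod>i\<in>I. Var i) - 1) ^ cut_size E I \<in> D_ideal n E"
  using Idl_poly_alg(2)[OF D_gens_polys, folded D_ideal_def] by blast

lemma slim_subset: "slim n E H \<Longrightarrow> H' \<subseteq> H \<Longrightarrow> slim n E H'"
  unfolding slim_def by (rule connected_graph_mono) auto

text \<open>The polynomials without slim square-free monomials form an ideal, since subsets of slim
  sets are slim, and it contains the generators. Thus the slim square-free monomials are linearly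
  independent in \<open>Phi_T n E\<close>.\<close>

lemma Phi_ideal_coeff_eq_0:
  fixes p :: "(nat set, 'k::field) mpoly"
  assumes E: "finite E" and p: "p \<in> Phi_ideal n E" and H: "H \<subseteq> E" "slim n E H"
  shows "Poly_Mapping.lookup p (edge_monom H) = 0"
proof -
  define L :: "(nat set, 'k) mpoly set"
    where "L = {p \<in> polys E. \<forall>H. H \<subseteq> E \<longrightarrow> slim n E H \<longrightarrow> Poly_Mapping.lookup p (edge_monom H) = 0}"
  have fin: "finite H" if "H \<subseteq> E" for H using that E finite_subset by blast
  have mult: "r * a \<in> L" if "r \<in> polys E" "a \<in> L" for r a
    using that
  proof (induction r rule: polys_induct)
    case (Const c)
    then show ?case by (auto simp: L_def lookup_Const_mult)
  next
    case (add p q)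
    then show ?case by (auto simp: L_def distrib_right lookup_add)
  next
    case (mult p e)
    have eq: "p * Var e * a = p * a * Var e" by (simp add: mult_ac)
    have "Poly_Mapping.lookup (p * a * Var e) (edge_monom H) = 0" if "H \<subseteq> E" "slim n E H" for H
    proof -
      have "slim n E (H - {e})" by (rule slim_subset[OF that(2)]) auto
      then have "Poly_Mapping.lookup (p * a) (edge_monom (H - {e})) = 0"
        using mult that(1) unfolding L_def by blast
      then show ?thesis by (simp add: lookup_edge_monom_mult_Var[OF fin[OF that(1)]])
    qed
    moreover have "p * a * Var e \<in> polys E" using mult by (auto simp: L_def)
    ultimately show ?case unfolding eq by (simp add: L_def)
  qed
  have "ideal L (poly_alg E)"
    unfolding poly_alg_ideal_iff using mult by (auto simp: L_def lookup_add)
  moreover have "Poly_Mapping.lookup ((Var e)\<^sup>2 :: (nat set, 'k) mpoly) (edge_monom H) = 0" if "H \<subseteq> E" for e H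
    unfolding power2_eq_square lookup_edge_monom_mult_Var[OF fin[OF that]]
    using lookup_edge_monom_mult_Var[of "H - {e}" "1 :: (nat set, 'k) mpoly" e] fin[OF that] by simp
  moreover have "Poly_Mapping.lookup (\<Prod>e\<in>K. Var e :: (nat set, 'k) mpoly) (edge_monom H) = 0"
    if "K \<subseteq> E" "\<not> slim n E K" "H \<subseteq> E" "slim n E H" for K H
  proof -
    have "(\<Prod>e\<in>K. Var e) = (Poly_Mapping.single (edge_monom K) 1 :: (nat set, 'k) mpoly)"
      using fin[OF that(1)] unfolding edge_monom_def
      by (induction K rule: finite_induct) (auto simp: Var_def mult_single)
    moreover have "edge_monom K \<noteq> edge_monom H"
    proof
      assume "edge_monom K = edge_monom H"
      then have "(if e \<in> K then 1 else 0) = (if e \<in> H then 1 else (0::nat))" for e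
        using lookup_edge_monom[OF fin[OF that(1)], of e] lookup_edge_monom[OF fin[OF that(3)], of e] by simp
      then have "K = H" by (auto split: if_splits) (metis zero_neq_one)+
      with that show False by simp
    qed
    ultimately show ?thesis by (simp add: lookup_single when_def)
  qed
  ultimately have "Phi_ideal n E \<subseteq> L"
    unfolding Phi_ideal_def using Phi_gens_polys[of E n, where 'k = 'k]
    by (intro Idl_poly_alg(3)) (auto simp: L_def)
  then show ?thesis using p H by (auto simp: L_def)
qed

section \<open>The substitution of \<open>Y_i\<close> for \<open>y_i\<close> on
  representatives\<close>

definition Y_poly :: "nat set set \<Rightarrow> nat \<Rightarrow> (nat set, 'k::field) mpoly" where
  "Y_poly E i = (\<Prod>e\<in>E. 1 + Const (incidence i e) * Var e)"

lemma Y_poly_polys: "Y_poly E i \<in> polys E"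
  unfolding Y_poly_def by (intro polys_prod) auto

lemma subst_Y_poly_polys: "mpoly_subst (Y_poly E) p \<in> polys E"
  by (rule subst_polys[of _ UNIV]) (auto simp: Y_poly_polys)

lemma cut_power_Y_poly:
  fixes n :: nat and E :: "nat set set"
  assumes G: "simple_graph n E" and I: "I \<subseteq> {0..n}" "I \<noteq> {}"
  shows "I \<noteq> {0..n} \<Longrightarrow> ((\<Prod>i\<in>I. Y_poly E i) - 1) ^ cut_size E I \<in> (Phi_ideal n E :: (nat set, 'k::field_char_0) mpoly set)"
    and "I = {0..n} \<Longrightarrow> (\<Prod>i\<in>I. Y_poly E i) - 1 \<in> (Phi_ideal n E :: (nat set, 'k) mpoly set)"
proof -
  have E: "finite E" and fI: "finite I" using simple_graph_finite[OF G] finite_subset[OF I(1)] by auto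
  define J :: "(nat set, 'k) mpoly set" where "J = var_restrict E -` Phi_ideal n E"
  interpret mpoly_ideal J unfolding J_def by (rule var_restrict_vimage_ideal[OF Phi_ideal_ideal])
  write cong_mod (infix "\<approx>" 50)
  have J: "p \<in> J \<longleftrightarrow> p \<in> Phi_ideal n E" if "p \<in> polys E" for p
    using that unfolding J_def by (rule var_restrict_vimage_iff)
  let ?F = "{e \<in> E. card (e \<inter> I) = 1}"
  define a where "a e = Const (cut_sign I e :: 'k) * Var e" for e
  have sq: "(Var e)\<^sup>2 \<in> J" if "e \<in> E" for e
    using Phi_ideal_square[OF that] that by (subst J) auto
  then have a2: "a e ^ 2 \<in> J" if "e \<in> E" for e
    using that by (auto simp: a_def power_mult_distrib intro: mult_mem)
  \<comment> \<open>Regrouped by edges, each edge contributes \<open>1 + a e\<close>, and this is 1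
    unless the edge leaves I.\<close>
  have "(\<Prod>i\<in>I. Y_poly E i) = (\<Prod>e\<in>E. \<Prod>i\<in>I. 1 + Const (incidence i e) * Var e)"
    unfolding Y_poly_def by (rule prod.swap)
  also have "\<dots> \<approx> (\<Prod>e\<in>E. 1 + a e)"
    unfolding a_def cut_sign_def by (intro cong_prod prod_one_plus_multiples sq)
  also have "(\<Prod>e\<in>E. 1 + a e) = (\<Prod>e\<in>?F. 1 + a e)"
  proof (intro prod.mono_neutral_right E ballI)
    fix e assume "e \<in> E - ?F"
    then show "1 + a e = 1" using cut_sign_eq_0_iff[OF G _ fI, of e, where 'k = 'k] by (simp add: a_def)
  qed auto
  finally have Y: "(\<Prod>i\<in>I. Y_poly E i) \<approx> (\<Prod>e\<in>?F. 1 + a e)" .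
  have pol: "(\<Prod>i\<in>I. Y_poly E i) \<in> (polys E :: (nat set, 'k) mpoly set)"
    by (intro polys_prod Y_poly_polys)
  {
    assume "I \<noteq> {0..n}"
    then obtain j where j: "j \<le> n" "j \<notin> I" using I(1) by fastforce
    obtain i where i: "i \<in> I" "i \<le> n" using I by fastforce
    \<comment> \<open>Removing all edges that leave I separates i from j.\<close>
    have "\<not> slim n E ?F"
    proof
      assume "slim n E ?F"
      from crossing_edge[OF this[unfolded slim_def] simple_graph_mono[OF G] i j(2,1)] show False by auto
    qed
    then have "(\<Prod>e\<in>?F. Var e) \<in> J"
      using Phi_ideal_not_slim[of ?F E n] by (subst J) (auto intro!: polys_prod)
    then have "prod a ?F \<in> J" by (simp add: a_def prod.distrib mult_mem)
    moreover obtain z where "((\<Prod>e\<in>?F. 1 + a e) - 1) ^ card ?F \<approx> z * prod a ?F"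
      using prod_one_plus_square_zero[of ?F a] a2 E by auto
    ultimately have "((\<Prod>e\<in>?F. 1 + a e) - 1) ^ card ?F \<in> J"
      using cong_mem mult_mem by blast
    then have "((\<Prod>i\<in>I. Y_poly E i) - 1) ^ cut_size E I \<in> J"
      unfolding cut_size_def using cong_mem[OF cong_power[OF cong_diff[OF Y cong_refl]]] by blast
    then show "((\<Prod>i\<in>I. Y_poly E i) - 1) ^ cut_size E I \<in> (Phi_ideal n E :: (nat set, 'k) mpoly set)"
      using J pol by auto
  next
    assume "I = {0..n}"
    then have "?F = {}" using G by (auto simp: simple_graph_def Int_absorb2)
    then have "(\<Prod>i\<in>I. Y_poly E i) \<approx> 1" using Y by (simp only: prod.empty)
    then show "(\<Prod>i\<in>I. Y_poly E i) - 1 \<in> (Phi_ideal n E :: (nat set, 'k) mpoly set)"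
      using J[of "(\<Prod>i\<in>I. Y_poly E i) - 1"] pol by (auto simp: cong_mod_def)
  }
qed

lemma subst_Y_poly_D_ideal:
  fixes p :: "(nat, 'k::field_char_0) mpoly"
  assumes G: "simple_graph n E" and p: "p \<in> D_ideal n E"
  shows "mpoly_subst (Y_poly E) p \<in> Phi_ideal n E"
proof -
  let ?L = "{p \<in> polys {0..n}. mpoly_subst (Y_poly E) p \<in> (Phi_ideal n E :: (nat set, 'k) mpoly set)}"
  have "mpoly_subst (Y_poly E) r \<in> polys E" for r :: "(nat, 'k) mpoly" by (rule subst_Y_poly_polys)
  then have "ideal ?L (poly_alg {0..n})"
    using Phi_ideal_ideal[where 'k = 'k, of n E] unfolding poly_alg_ideal_iff
    by (auto simp: subst_add subst_mult)
  then have "D_ideal n E \<subseteq> ?L"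
    unfolding D_ideal_def using D_gens_polys[of n E, where 'k = 'k]
    by (intro Idl_poly_alg(3)) (auto simp: subst_simps intro!: cut_power_Y_poly[OF G, where 'k = 'k])
  then show ?thesis using p by auto
qed

text \<open>Injectivity. Put f = q(exp x), with the variable of vertex 0 eliminated. Then f(X) is
  congruent to q(Y), which vanishes, so f lies in the span of the cut powers. Substituting
  logarithms s of the y turns f back into q modulo the D-ideal and sends the cut powers into that
  ideal.\<close>

lemma D_ideal_if_subst_Y_poly:
  fixes q :: "(nat, 'k::field_char_0) mpoly"
  assumes G: "simple_graph n E" and q: "q \<in> polys {0..n}" and Yq: "mpoly_subst (Y_poly E) q \<in> Phi_ideal n E"
  shows "q \<in> D_ideal n E"
proof -
  have E: "finite E" using G by (rule simple_graph_finite)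
  \<comment> \<open>Large enough for both uses of \<open>texp_sum\<close>: \<open>card E\<close>
    summands of square zero, and at most n + 1 logarithms with nilpotency exponent
    \<open>Suc (card E)\<close>.\<close>
  define N where "N = Suc (2 * card E + Suc n * Suc (card E))"
  have N: "N \<ge> 1" by (simp add: N_def)
  define x :: "nat \<Rightarrow> (nat, 'k) mpoly" where "x i = (if i = 0 then - (\<Sum>j\<in>{1..n}. Var j) else Var i)" for i
  define f where "f = mpoly_subst (\<lambda>i. texp N (x i)) q"
  have xp: "x i \<in> polys {1..n}" if "i \<in> {0..n}" for i
    using that by (auto simp: x_def intro!: polys_sum)
  have fp: "f \<in> polys {1..n}"
    unfolding f_def by (rule subst_polys[OF q]) (intro texp_polys xp)
  have "edge_coeff E H f = 0" if H: "H \<subseteq> E" "connected_graph n ({} \<union> (E - H))" for H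
  proof -
    define J :: "(nat set, 'k) mpoly set" where "J = var_restrict E -` Phi_ideal n E"
    interpret mpoly_ideal J unfolding J_def by (rule var_restrict_vimage_ideal[OF Phi_ideal_ideal])
    write cong_mod (infix "\<approx>" 50)
    have J: "p \<in> J \<longleftrightarrow> p \<in> Phi_ideal n E" if "p \<in> polys E" for p
      using that unfolding J_def by (rule var_restrict_vimage_iff)
    have sq: "(Const c * Var e)\<^sup>2 \<in> J" if "e \<in> E" for e c
      using Phi_ideal_square[OF that, where 'k = 'k, of n] that J[of "(Var e)\<^sup>2"]
      by (auto simp: power_mult_distrib intro: mult_mem)
    have X: "texp N (edge_subst E i) \<approx> Y_poly E i" for i
    proof -
      have "Y_poly E i \<approx> (\<Prod>e\<in>E. texp N (Const (incidence i e) * Var e))"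
        unfolding Y_poly_def by (intro cong_prod cong_sym[OF texp_square_zero[OF N]] sq)
      also have "\<dots> \<approx> texp N (edge_subst E i)"
        unfolding edge_subst_def using texp_sum[OF E, of "\<lambda>e. Const (incidence i e) * Var e" 2 N] sq
        by (auto simp: N_def)
      finally show ?thesis by (rule cong_sym)
    qed
    have x: "mpoly_subst (edge_subst E) (x i) = edge_subst E i" if i: "i \<in> {0..n}" for i
    proof (cases "i = 0")
      case True
      \<comment> \<open>Every edge has one endpoint of each sign, so the \<open>X_i\<close> sum to
        zero; this justifies the choice of \<open>x 0\<close>.\<close>
      have "(\<Sum>j\<in>{0..n}. edge_subst E j) = (\<Sum>e\<in>E. Const (cut_sign {0..n} e :: 'k) * Var e)"
        unfolding edge_subst_def cut_sign_def Const_sum sum_distrib_right by (rule sum.swap)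
      also have "\<dots> = 0"
      proof (intro sum.neutral ballI)
        fix e assume e: "e \<in> E"
        then have "card (e \<inter> {0..n}) \<noteq> 1" using G by (auto simp: simple_graph_def Int_absorb2)
        then show "Const (cut_sign {0..n} e :: 'k) * Var e = 0"
          using cut_sign_eq_0_iff[OF G e, of "{0..n}", where 'k = 'k] by simp
      qed
      finally have "edge_subst E 0 + (\<Sum>j\<in>{1..n}. edge_subst E j) = (0 :: (nat set, 'k) mpoly)"
        by (simp add: sum.atLeast_Suc_atMost)
      then show ?thesis using True by (simp add: x_def subst_simps add_eq_0_iff2)
    qed (simp add: x_def)
    have "mpoly_subst (edge_subst E) f = mpoly_subst (\<lambda>i. texp N (mpoly_subst (edge_subst E) (x i))) q"
      by (simp add: f_def subst_subst subst_texp)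
    also have "\<dots> \<approx> mpoly_subst (Y_poly E) q"
      by (rule subst_cong[OF q]) (use x X in simp)
    finally have "mpoly_subst (edge_subst E) f \<in> J"
      using cong_mem J[OF subst_Y_poly_polys] Yq by blast
    moreover have "mpoly_subst (edge_subst E) f \<in> polys E"
      by (rule subst_polys[of _ UNIV]) (auto simp: edge_subst_def intro!: polys_sum)
    ultimately have "mpoly_subst (edge_subst E) f \<in> Phi_ideal n E" using J by blast
    then show ?thesis unfolding edge_coeff_def
      using Phi_ideal_coeff_eq_0[OF E] H by (simp add: slim_def)
  qed
  then have f: "f \<in> cut_power_span n {} E"
    using G fp E by (intro annihilator_cut_power_span[of E]) (auto simp: contracted_polys_def)

  define J :: "(nat, 'k) mpoly set" where "J = var_restrict {0..n} -` D_ideal n E"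
  interpret mpoly_ideal J unfolding J_def by (rule var_restrict_vimage_ideal[OF D_ideal_ideal])
  write cong_mod (infix "\<approx>" 50)
  have J: "p \<in> J \<longleftrightarrow> p \<in> D_ideal n E" if "p \<in> polys {0..n}" for p
    using that unfolding J_def by (rule var_restrict_vimage_iff)
  have prod_polys: "(\<Prod>i\<in>I. Var i) \<in> (polys {0..n} :: (nat, 'k) mpoly set)" if "I \<subseteq> {0..n}" for I
    using that by (intro polys_prod) auto
  have full: "(\<Prod>i\<in>{0..n}. Var i) - 1 \<in> J"
    using D_ideal_full J[of "(\<Prod>i\<in>{0..n}. Var i) - 1"] prod_polys by blast
  have cut: "((\<Prod>i\<in>I. Var i) - 1) ^ cut_size E I \<in> J" if "I \<noteq> {}" "I \<subset> {0..n}" for I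
    using D_ideal_cut[OF that] J[of "((\<Prod>i\<in>I. Var i) - 1) ^ cut_size E I"] prod_polys that by blast
  have "\<exists>s. s ^ Suc (card E) \<in> J \<and> texp N s \<approx> Var i" if i: "i \<in> {0..n}" for i
  proof -
    \<comment> \<open>The singleton cut makes \<open>y_i\<close> unipotent. For n = 0 the singleton
      is the whole vertex set, and the relation for the full product takes its place.\<close>
    have "(Var i - 1) ^ Suc (card E) \<in> J"
    proof (cases "{i} = {0..n}")
      case True
      then have "Var i - 1 \<in> J" using full by (simp flip: True)
      then show ?thesis using power_mem_mono[of "Var i - 1" 1 "Suc (card E)"] by simp
    next
      case False
      have "cut_size E {i} \<le> Suc (card E)"
        unfolding cut_size_def using E by (intro le_SucI card_mono) auto
      moreover have "(Var i - 1) ^ cut_size E {i} \<in> J" using cut[of "{i}"] False i psubsetI[of "{i}" "{0..n}"] by simp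
      ultimately show ?thesis using power_mem_mono by blast
    qed
    from texp_log[OF N this] show ?thesis by metis
  qed
  then obtain s where s: "\<And>i. i \<in> {0..n} \<Longrightarrow> s i ^ Suc (card E) \<in> J"
    "\<And>i. i \<in> {0..n} \<Longrightarrow> texp N (s i) \<approx> Var i" by metis
  have sums: "\<exists>B. sum s I ^ B \<in> J" "texp N (sum s I) \<approx> (\<Prod>i\<in>I. Var i)" if I: "I \<subseteq> {0..n}" for I
  proof -
    have fI: "finite I" and "card I \<le> Suc n"
      using I finite_subset card_mono[OF _ I] by auto
    then have "card I * Suc (card E) \<le> Suc n * Suc (card E)" using mult_le_mono1 by blast
    then have "card I * Suc (card E) \<le> N" by (simp only: N_def)
    note ts = texp_sum[OF fI _ this, of s]
    then show "\<exists>B. sum s I ^ B \<in> J" using s(1) I by blast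
    have "texp N (sum s I) \<approx> (\<Prod>i\<in>I. texp N (s i))" using ts s(1) I by (blast intro: cong_sym)
    also have "\<dots> \<approx> (\<Prod>i\<in>I. Var i)" using s(2) I by (intro cong_prod) auto
    finally show "texp N (sum s I) \<approx> (\<Prod>i\<in>I. Var i)" .
  qed
  have sum_power: "sum s I ^ m \<in> J" if "I \<subseteq> {0..n}" "((\<Prod>i\<in>I. Var i) - 1) ^ m \<in> J" for I m
    using sums[OF that(1)] power_mem_of_texp[OF N _ _ that(2)] by blast
  \<comment> \<open>The full product relation, taken with exponent 1, becomes linear in the
    logarithms and matches the elimination of \<open>x 0\<close>.\<close>
  have "sum s {0..n} \<in> J" using sum_power[of "{0..n}" 1] full by simp
  moreover have "- (\<Sum>j\<in>{1..n}. s j) - s 0 = - sum s {0..n}" by (simp add: sum.atLeast_Suc_atMost)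
  ultimately have s0: "- (\<Sum>j\<in>{1..n}. s j) \<approx> s 0"
    unfolding cong_mod_def using uminus_mem by metis
  have "mpoly_subst s f \<in> J"
    using f
  proof induction
    case (step p I g)
    then have "I \<noteq> {}" "I \<subset> {0..n}" by (auto simp: cuts_def)
    then have "sum s I ^ cut_size E I \<in> J" using sum_power cut by blast
    then show ?case using step by (auto simp: subst_simps cut_form_def intro: add_mem mult_mem)
  qed simp
  moreover have "mpoly_subst s f \<approx> q"
  proof -
    have "mpoly_subst s f = mpoly_subst (\<lambda>i. texp N (mpoly_subst s (x i))) q"
      by (simp add: f_def subst_subst subst_texp)
    also have "\<dots> \<approx> mpoly_subst Var q"
    proof (rule subst_cong[OF q])
      fix i assume i: "i \<in> {0..n}"
      have "mpoly_subst s (x i) \<approx> s i"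
        using s0 by (cases "i = 0") (auto simp: x_def subst_simps)
      from cong_trans[OF texp_cong[OF this] s(2)[OF i]]
      show "texp N (mpoly_subst s (x i)) \<approx> Var i" .
    qed
    also have "mpoly_subst Var q = q" by (rule subst_id_on[OF q]) simp
    finally show ?thesis .
  qed
  ultimately have "q \<in> J" using cong_mem by blast
  then show ?thesis using J[OF q] by simp
qed

section \<open>The filtered isomorphism\<close>

lemma quot_alg_sel:
  "carrier (quot_alg A I) = a_rcosets\<^bsub>A\<^esub> I"
  "monoid.mult (quot_alg A I) = rcoset_mult A I"
  "one (quot_alg A I) = I +>\<^bsub>A\<^esub> \<one>\<^bsub>A\<^esub>"
  "ring.zero (quot_alg A I) = I"
  "add (quot_alg A I) = set_add A"
  "module.smult (quot_alg A I) = (\<lambda>c S. \<Union>x\<in>S. I +>\<^bsub>A\<^esub> (c \<odot>\<^bsub>A\<^esub> x))"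
  by (simp_all add: quot_alg_def ring.extend_def module.fields_def FactRing_def)

text \<open>Reduces the record operations of a quotient of \<open>poly_alg V\<close> to arithmetic
  on representatives.\<close>

locale poly_quotient =
  fixes V :: "'v set" and I :: "('v, 'k::field) mpoly set"
  assumes ideal_I: "ideal I (poly_alg V)"
begin

abbreviation cls :: "('v, 'k) mpoly \<Rightarrow> ('v, 'k) mpoly set" where
  "cls p \<equiv> I +>\<^bsub>poly_alg V\<^esub> p"

abbreviation Q :: "('k, ('v, 'k) mpoly set) module" where
  "Q \<equiv> quot_alg (poly_alg V) I"

lemma cls_def': "cls p = {a + p | a. a \<in> I}"
  by (auto simp: a_r_coset_def r_coset_def)

lemma I_props: "I \<subseteq> polys V" "0 \<in> I" "a \<in> I \<Longrightarrow> b \<in> I \<Longrightarrow> a + b \<in> I"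
  "a \<in> I \<Longrightarrow> r \<in> polys V \<Longrightarrow> r * a \<in> I" "a \<in> I \<Longrightarrow> - a \<in> I"
proof -
  note * = ideal_I[unfolded poly_alg_ideal_iff]
  show "I \<subseteq> polys V" "0 \<in> I" "a \<in> I \<Longrightarrow> b \<in> I \<Longrightarrow> a + b \<in> I"
    "a \<in> I \<Longrightarrow> r \<in> polys V \<Longrightarrow> r * a \<in> I" using * by auto
  show "- a \<in> I" if "a \<in> I"
  proof -
    have "(- 1) * a \<in> I" using * that polys_uminus[OF polys_one] by blast
    then show ?thesis by simp
  qed
qed

lemma cls_eq_iff: "cls p = cls q \<longleftrightarrow> p - q \<in> I"
proof
  assume "cls p = cls q"
  moreover have "p \<in> cls p" using I_props(2) by (auto simp: cls_def')
  ultimately show "p - q \<in> I" by (auto simp: cls_def')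
next
  assume pq: "p - q \<in> I"
  have "\<exists>b\<in>I. a + p = b + q" if "a \<in> I" for a
    using I_props(3)[OF that pq] by (intro bexI[of _ "a + (p - q)"]) auto
  moreover have "\<exists>b\<in>I. a + q = b + p" if "a \<in> I" for a
    using I_props(3)[OF that I_props(5)[OF pq]] by (intro bexI[of _ "a + - (p - q)"]) auto
  ultimately show "cls p = cls q" by (auto simp: cls_def')
qed

lemma carrier_Q: "carrier Q = cls ` polys V"
  by (auto simp: quot_alg_sel A_RCOSETS_def' a_r_coset_def[symmetric] A_RCOSETS_defs)

lemma zero_Q: "\<zero>\<^bsub>Q\<^esub> = cls 0"
  by (auto simp: quot_alg_sel cls_def')

lemma one_Q: "\<one>\<^bsub>Q\<^esub> = cls 1"
  by (simp add: quot_alg_sel)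

lemma add_Q: "p \<in> polys V \<Longrightarrow> q \<in> polys V \<Longrightarrow> cls p \<oplus>\<^bsub>Q\<^esub> cls q = cls (p + q)"
  using ideal.a_rcos_sum[OF ideal_I, of p q] by (simp add: quot_alg_sel)

lemma mult_Q: "p \<in> polys V \<Longrightarrow> q \<in> polys V \<Longrightarrow> cls p \<otimes>\<^bsub>Q\<^esub> cls q = cls (p * q)"
  using ideal.rcoset_mult_add[OF ideal_I, of p q] by (simp add: quot_alg_sel)

text \<open>All members of the coset yield the same scaled coset, and the coset is nonempty, so the
  union in \<open>quot_alg\<close> collapses to one class.\<close>

lemma smult_Q: "c \<odot>\<^bsub>Q\<^esub> cls p = cls (Const c * p)"
proof -
  have "cls (Const c * x) = cls (Const c * p)" if "x \<in> cls p" for x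
  proof -
    have "x - p \<in> I" using that by (auto simp: cls_def')
    then have "Const c * (x - p) \<in> I" by (rule I_props(4)) simp
    then show ?thesis unfolding cls_eq_iff by (simp add: right_diff_distrib)
  qed
  moreover have "cls p \<noteq> {}" using I_props(2) by (auto simp: cls_def')
  ultimately show ?thesis by (simp add: quot_alg_sel)
qed

lemma cring_Q: "cring Q"
proof (rule cringI)
  show "abelian_group Q"
  proof (rule abelian_groupI)
    fix x assume "x \<in> carrier Q"
    then obtain p where "p \<in> polys V" "x = cls p" by (auto simp: carrier_Q)
    then show "\<exists>y\<in>carrier Q. y \<oplus>\<^bsub>Q\<^esub> x = \<zero>\<^bsub>Q\<^esub>"
      by (intro bexI[of _ "cls (- p)"]) (auto simp: carrier_Q add_Q zero_Q)
  qed (auto simp: carrier_Q add_Q zero_Q add_ac)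
  show "comm_monoid Q"
    by (rule comm_monoidI) (auto simp: carrier_Q mult_Q one_Q mult_ac)
qed (auto simp: carrier_Q mult_Q add_Q distrib_right)

lemma minus_Q: "p \<in> polys V \<Longrightarrow> \<ominus>\<^bsub>Q\<^esub> cls p = cls (- p)"
proof -
  assume p: "p \<in> polys V"
  interpret cring Q by (rule cring_Q)
  show ?thesis using p by (intro minus_equality) (auto simp: carrier_Q add_Q zero_Q)
qed

lemma finprod_Q:
  assumes "finite A" "\<And>x. x \<in> A \<Longrightarrow> f x \<in> polys V"
  shows "finprod Q (\<lambda>x. cls (f x)) A = cls (prod f A)"
proof -
  interpret cring Q by (rule cring_Q)
  show ?thesis using assms
  proof (induction A rule: finite_induct)
    case (insert x A)
    then have "prod f A \<in> polys V" by (intro polys_prod) auto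
    moreover have "finprod Q (\<lambda>x. cls (f x)) (insert x A) = cls (f x) \<otimes>\<^bsub>Q\<^esub> finprod Q (\<lambda>x. cls (f x)) A"
      using insert by (intro finprod_insert) (auto simp: carrier_Q)
    ultimately show ?case using insert by (simp add: mult_Q)
  qed (simp add: one_Q)
qed

lemma submodule_Q_I:
  assumes "P \<subseteq> polys V" "0 \<in> P" "\<And>p q. p \<in> P \<Longrightarrow> q \<in> P \<Longrightarrow> p + q \<in> P"
    "\<And>c p. p \<in> P \<Longrightarrow> Const c * p \<in> P"
  shows "submodule (cls ` P) (ring_of_type_algebra :: 'k ring) Q"
proof -
  interpret cring Q by (rule cring_Q)
  have "- p \<in> P" if "p \<in> P" for p
    using assms(4)[OF that, of "-1"] by (simp add: Const_uminus)
  then have inv: "\<ominus>\<^bsub>Q\<^esub> x \<in> cls ` P" if "x \<in> cls ` P" for x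
    using that assms(1) by (auto simp: minus_Q subset_iff)
  have "subgroup (cls ` P) (add_monoid Q)"
  proof (rule add.subgroupI)
    show "cls ` P \<subseteq> carrier Q" "cls ` P \<noteq> {}" using assms(1,2) by (auto simp: carrier_Q)
    show "\<ominus>\<^bsub>Q\<^esub> x \<in> cls ` P" if "x \<in> cls ` P" for x
      using that by (rule inv)
    show "x \<oplus>\<^bsub>Q\<^esub> y \<in> cls ` P" if "x \<in> cls ` P" "y \<in> cls ` P" for x y
      using that assms(1,3) by (auto simp: add_Q subset_iff)
  qed
  then show ?thesis
    by (intro submodule.intro submodule_axioms.intro) (auto simp: smult_Q assms(4))
qed

lemma submodule_Q_E:
  assumes "submodule B (ring_of_type_algebra :: 'k ring) Q"
  shows "cls 0 \<in> B" "x \<in> B \<Longrightarrow> y \<in> B \<Longrightarrow> x \<oplus>\<^bsub>Q\<^esub> y \<in> B" "x \<in> B \<Longrightarrow> c \<odot>\<^bsub>Q\<^esub> x \<in> B"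
proof -
  interpret submodule B "ring_of_type_algebra :: 'k ring" Q by fact
  show "cls 0 \<in> B" using one_closed by (simp add: zero_Q)
  show "x \<in> B \<Longrightarrow> y \<in> B \<Longrightarrow> x \<oplus>\<^bsub>Q\<^esub> y \<in> B" using m_closed by simp
  show "x \<in> B \<Longrightarrow> c \<odot>\<^bsub>Q\<^esub> x \<in> B" using smult_closed by (simp add: ring_of_type_algebra_def)
qed

lemma subring_Q_I:
  assumes "P \<subseteq> polys V" "1 \<in> P" "\<And>p q. p \<in> P \<Longrightarrow> q \<in> P \<Longrightarrow> p + q \<in> P"
    "\<And>p. p \<in> P \<Longrightarrow> - p \<in> P" "\<And>p q. p \<in> P \<Longrightarrow> q \<in> P \<Longrightarrow> p * q \<in> P"
  shows "subring (cls ` P) Q"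
proof -
  interpret cring Q by (rule cring_Q)
  show ?thesis
    by (rule subringI) (use assms in \<open>auto simp: carrier_Q one_Q add_Q mult_Q minus_Q subset_iff\<close>)
qed

end

lemma total_degree_le_iff: "total_degree_le p k \<longleftrightarrow> (\<forall>m\<in>Poly_Mapping.keys p. exponent_degree m \<le> k)"
  by (simp add: total_degree_le_def exponent_degree_def)

text \<open>With its converse below, this matches the number of factors, which filters
  \<open>K_T\<close>, with the total degree, which filters \<open>D_T\<close>.\<close>

lemma prod_list_Var_single:
  "\<exists>m. foldr (*) (map Var is) 1 = (Poly_Mapping.single m 1 :: ('v, 'k::field) mpoly)
     \<and> Poly_Mapping.keys m = set is \<and> exponent_degree m = length is"
proof (induction "is")
  case Nil
  show ?case by (rule exI[of _ 0]) simp
next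
  case (Cons i "is")
  then obtain m where "foldr (*) (map Var is) 1 = (Poly_Mapping.single m 1 :: ('v, 'k) mpoly)"
    "Poly_Mapping.keys m = set is" "exponent_degree m = length is" by blast
  then show ?case
    by (intro exI[of _ "Poly_Mapping.single i 1 + m"])
      (simp add: single_Suc_exponent[unfolded One_nat_def] keys_single_add[unfolded One_nat_def]
        exponent_degree_add mult.commute)
qed

lemma single_prod_list_Var:
  "\<exists>is. (Poly_Mapping.single m 1 :: ('v, 'k::field) mpoly) = foldr (*) (map Var is) 1
     \<and> set is = Poly_Mapping.keys m \<and> length is = exponent_degree m"
proof (induction m rule: exponent_induct)
  case zero
  show ?case by (rule exI[of _ "[]"]) simp
next
  case (add m v)
  then obtain "is" where "(Poly_Mapping.single m 1 :: ('v, 'k) mpoly) = foldr (*) (map Var is) 1"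
    "set is = Poly_Mapping.keys m" "length is = exponent_degree m" by blast
  then show ?case
    by (intro exI[of _ "v # is"])
      (simp add: single_Suc_exponent[unfolded One_nat_def] keys_single_add[unfolded One_nat_def]
        exponent_degree_add mult.commute)
qed

context
  fixes n :: nat and E :: "nat set set"
  assumes G: "simple_graph n E"
begin

interpretation Phi: poly_quotient E "Phi_ideal n E :: (nat set, 'k::field_char_0) mpoly set"
  by (rule poly_quotient.intro[OF Phi_ideal_ideal])

interpretation D: poly_quotient "{0..n}" "D_ideal n E :: (nat, 'k::field_char_0) mpoly set"
  by (rule poly_quotient.intro[OF D_ideal_ideal])

abbreviation \<theta> :: "(nat, 'k::field_char_0) mpoly \<Rightarrow> (nat set, 'k) mpoly" where
  "\<theta> \<equiv> mpoly_subst (Y_poly E)"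

lemma Y_T_eq: "Y_T n E i = (Phi.cls (Y_poly E i) :: (nat set, 'k::field_char_0) mpoly set)"
proof -
  interpret cring "Phi.Q :: ('k, (nat set, 'k) mpoly set) module" by (rule Phi.cring_Q)
  have "Y_T n E i = finprod Phi.Q (\<lambda>e. Phi.cls (1 + Const (incidence i e) * Var e :: (nat set, 'k) mpoly)) E"
    unfolding Y_T_def Phi_T_def phi_def
    by (rule finprod_cong) (auto simp: Phi.carrier_Q Phi.smult_Q Phi.add_Q Phi.one_Q simp_implies_def)
  also have "\<dots> = Phi.cls (Y_poly E i)"
    unfolding Y_poly_def using simple_graph_finite[OF G] by (intro Phi.finprod_Q) auto
  finally show ?thesis .
qed

text \<open>The classes on the right form a subalgebra containing the generators; conversely,
  induction on polynomials puts each of them into every such subalgebra.\<close>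

lemma carrier_K_T: "carrier (K_T n E) = (\<lambda>p. Phi.cls (\<theta> p)) ` (polys {0..n} :: (nat, 'k::field_char_0) mpoly set)"
proof -
  let ?P = "\<theta> ` (polys {0..n} :: (nat, 'k) mpoly set)"
  let ?S = "insert \<one>\<^bsub>Phi.Q\<^esub> (Y_T n E ` {0..n}) :: (nat set, 'k) mpoly set set"
  have P: "?P \<subseteq> polys E" using subst_Y_poly_polys by auto
  have add: "p + q \<in> ?P" if "p \<in> ?P" "q \<in> ?P" for p q
    using that by (auto simp: subst_add[symmetric])
  have mult: "p * q \<in> ?P" if "p \<in> ?P" "q \<in> ?P" for p q
    using that by (auto simp: subst_mult[symmetric])
  have const: "Const c \<in> ?P" for c
    using subst_Const[of "Y_poly E" c] by (metis imageI polys_Const)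
  have one: "1 \<in> ?P" using const[of 1] by simp
  have zero: "0 \<in> ?P" using const[of 0] by simp
  have um: "- p \<in> ?P" if "p \<in> ?P" for p
    using mult[OF const[of "-1"] that] by (simp add: Const_uminus)
  have "subring (Phi.cls ` ?P) Phi.Q"
    by (rule Phi.subring_Q_I[OF P one add um mult])
  moreover have "submodule (Phi.cls ` ?P) (ring_of_type_algebra :: 'k ring) Phi.Q"
    by (rule Phi.submodule_Q_I[OF P zero add mult[OF const]])
  moreover have "?S \<subseteq> Phi.cls ` ?P"
  proof -
    have "Y_T n E i \<in> Phi.cls ` ?P" if "i \<in> {0..n}" for i
      using that subst_Var[of "Y_poly E" i] unfolding Y_T_eq by (metis imageI polys_Var)
    then show ?thesis using one by (auto simp: Phi.one_Q)
  qed
  moreover have "Phi.cls (\<theta> p) \<in> B"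
    if B: "subring B Phi.Q" "submodule B (ring_of_type_algebra :: 'k ring) Phi.Q" "?S \<subseteq> B"
      and p: "p \<in> polys {0..n}" for B and p :: "(nat, 'k) mpoly"
    using p
  proof (induction p rule: polys_induct)
    case (Const c)
    have "c \<odot>\<^bsub>Phi.Q\<^esub> Phi.cls 1 \<in> B" using B(3)
      by (intro Phi.submodule_Q_E(3)[OF B(2)]) (simp flip: Phi.one_Q)
    then show ?case by (simp add: Phi.smult_Q)
  next
    case (add p q)
    then show ?case using Phi.submodule_Q_E(2)[OF B(2), of "Phi.cls (\<theta> p)" "Phi.cls (\<theta> q)"]
      by (simp add: Phi.add_Q subst_Y_poly_polys subst_add)
  next
    case (mult p i)
    interpret subring B "Phi.Q :: ('k, (nat set, 'k) mpoly set) module" by (rule B(1))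
    have "Phi.cls (Y_poly E i) \<in> B" using B(3) mult(1) by (auto simp: Y_T_eq)
    then have "Phi.cls (\<theta> p) \<otimes>\<^bsub>Phi.Q\<^esub> Phi.cls (Y_poly E i) \<in> B" using mult(3) by simp
    then show ?case by (simp add: Phi.mult_Q subst_Y_poly_polys Y_poly_polys subst_mult)
  qed
  ultimately have "\<Inter>{B. subring B Phi.Q \<and> submodule B (ring_of_type_algebra :: 'k ring) Phi.Q \<and> ?S \<subseteq> B} = Phi.cls ` ?P"
    by blast
  then show ?thesis by (simp add: K_T_def generated_subalg_def Phi_T_def image_image)
qed

text \<open>The classes coming from degree at most k form a subspace containing all products of at
  most k generators, and each monomial of degree at most k maps to such a product.\<close>

lemma K_T_filtration_eq:
  "K_T_filtration n E k = (\<lambda>p. Phi.cls (\<theta> p)) ` {p :: (nat, 'k::field_char_0) mpoly. p \<in> polys {0..n} \<and> total_degree_le p k}"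
proof -
  let ?D = "{p :: (nat, 'k) mpoly. p \<in> polys {0..n} \<and> total_degree_le p k}"
  let ?S = "{foldr (\<otimes>\<^bsub>Phi.Q\<^esub>) (map (Y_T n E) is) \<one>\<^bsub>Phi.Q\<^esub> | is. set is \<subseteq> {0..n} \<and> length is \<le> k} :: (nat set, 'k) mpoly set set"
  have fold: "foldr (\<otimes>\<^bsub>Phi.Q\<^esub>) (map (Y_T n E) is) \<one>\<^bsub>Phi.Q\<^esub> = Phi.cls (\<theta> (foldr (*) (map Var is) 1) :: (nat set, 'k) mpoly)" for "is"
    by (induction "is") (simp_all add: Phi.one_Q Y_T_eq Phi.mult_Q Y_poly_polys subst_Y_poly_polys subst_mult)
  have Dadd: "p + q \<in> ?D" if "p \<in> ?D" "q \<in> ?D" for p q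
    using that keys_add[of p q] by (auto simp: total_degree_le_iff)
  have Dsmult: "Const c * p \<in> ?D" if "p \<in> ?D" for c p
    using that by (auto simp: total_degree_le_iff in_keys_iff lookup_Const_mult)
  have D0: "0 \<in> ?D" by (simp add: total_degree_le_iff)
  have sub: "submodule (Phi.cls ` \<theta> ` ?D) (ring_of_type_algebra :: 'k ring) Phi.Q"
  proof (rule Phi.submodule_Q_I)
    show "\<theta> ` ?D \<subseteq> polys E" using subst_Y_poly_polys by blast
    show "0 \<in> \<theta> ` ?D" by (rule image_eqI[OF _ D0]) simp
    show "p + q \<in> \<theta> ` ?D" if pq: "p \<in> \<theta> ` ?D" "q \<in> \<theta> ` ?D" for p q
    proof -
      obtain a b where ab: "a \<in> ?D" "b \<in> ?D" "p = \<theta> a" "q = \<theta> b" using pq by blast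
      then have "p + q = \<theta> (a + b)" by (simp add: subst_add)
      then show ?thesis using Dadd[OF ab(1,2)] by blast
    qed
    show "Const c * p \<in> \<theta> ` ?D" if p: "p \<in> \<theta> ` ?D" for c p
    proof -
      obtain a where a: "a \<in> ?D" "p = \<theta> a" using p by blast
      then have "Const c * p = \<theta> (Const c * a)" by (simp add: subst_mult)
      then show ?thesis using Dsmult[OF a(1)] by blast
    qed
  qed
  have gens: "?S \<subseteq> Phi.cls ` \<theta> ` ?D"
  proof
    fix x assume "x \<in> ?S"
    then obtain "is" where "is": "x = Phi.cls (\<theta> (foldr (*) (map Var is) 1))" "set is \<subseteq> {0..n}" "length is \<le> k"
      unfolding fold mem_Collect_eq by (elim exE conjE) (rule that)
    obtain m where m: "foldr (*) (map Var is) 1 = (Poly_Mapping.single m 1 :: (nat, 'k) mpoly)"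
      "Poly_Mapping.keys m = set is" "exponent_degree m = length is" 
      using prod_list_Var_single[of "is", where 'k = 'k] by (elim exE conjE) (rule that)
    have "foldr (*) (map Var is) 1 \<in> ?D"
      using "is"(2,3) m(2,3) unfolding m(1) mem_Collect_eq by (simp add: total_degree_le_iff polys_single)
    from imageI[OF imageI[OF this]] show "x \<in> Phi.cls ` \<theta> ` ?D" unfolding "is"(1) .
  qed
  have least: "Phi.cls (\<theta> p) \<in> B"
    if B: "submodule B (ring_of_type_algebra :: 'k ring) Phi.Q" "?S \<subseteq> B" and p: "p \<in> ?D" for B p
  proof -
    have single: "Phi.cls (\<theta> (Poly_Mapping.single m c)) \<in> B" if m_key: "m \<in> Poly_Mapping.keys p" for m c
    proof -
      obtain "is" where "is": "(Poly_Mapping.single m 1 :: (nat, 'k) mpoly) = foldr (*) (map Var is) 1"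
        "set is = Poly_Mapping.keys m" "length is = exponent_degree m" 
        using single_prod_list_Var[of m, where 'k = 'k] by (elim exE conjE) (rule that)
      have "set is \<subseteq> {0..n}" "length is \<le> k"
        using p m_key "is"(2,3) by (auto simp: polys_def total_degree_le_iff)
      then have "Phi.cls (\<theta> (Poly_Mapping.single m 1)) \<in> B"
        using B(2) unfolding "is"(1) fold[symmetric] by auto
      from Phi.submodule_Q_E(3)[OF B(1) this, of c]
      have "Phi.cls (\<theta> (Const c * Poly_Mapping.single m 1)) \<in> B" by (simp add: Phi.smult_Q subst_mult)
      then show ?thesis by (simp add: Const_def mult_single)
    qed
    have "Phi.cls (\<theta> (\<Sum>m\<in>F. Poly_Mapping.single m (Poly_Mapping.lookup p m))) \<in> B"
      if "F \<subseteq> Poly_Mapping.keys p" for F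
      using finite_subset[OF that finite_keys] that
    proof (induction F rule: finite_induct)
      case empty
      show ?case using Phi.submodule_Q_E(1)[OF B(1)] by simp
    next
      case (insert m F)
      then show ?case using Phi.submodule_Q_E(2)[OF B(1) single[of m "Poly_Mapping.lookup p m"]]
        by (simp add: subst_add Phi.add_Q[OF subst_Y_poly_polys subst_Y_poly_polys, symmetric])
    qed
    from this[OF subset_refl] show ?thesis by (simp only: mpoly_sum_singles[symmetric])
  qed
  have "\<Inter>{B. submodule B (ring_of_type_algebra :: 'k ring) Phi.Q \<and> ?S \<subseteq> B} = Phi.cls ` \<theta> ` ?D"
  proof (rule equalityI)
    show "\<Inter>{B. submodule B (ring_of_type_algebra :: 'k ring) Phi.Q \<and> ?S \<subseteq> B} \<subseteq> Phi.cls ` \<theta> ` ?D"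
      by (rule Inter_lower) (rule CollectI, rule conjI[OF sub gens])
    show "Phi.cls ` \<theta> ` ?D \<subseteq> \<Inter>{B. submodule B (ring_of_type_algebra :: 'k ring) Phi.Q \<and> ?S \<subseteq> B}"
    proof (rule Inter_greatest)
      fix B assume "B \<in> {B. submodule B (ring_of_type_algebra :: 'k ring) Phi.Q \<and> ?S \<subseteq> B}"
      then have "submodule B (ring_of_type_algebra :: 'k ring) Phi.Q" "?S \<subseteq> B" by simp_all
      from least[OF this] show "Phi.cls ` \<theta> ` ?D \<subseteq> B" by (simp only: image_subset_iff) simp
    qed
  qed
  then show ?thesis by (simp add: K_T_filtration_def lin_span_def Phi_T_def image_image)
qed

lemma K_T_sel:
  "monoid.mult (K_T n E) = monoid.mult Phi.Q" "add (K_T n E) = add Phi.Q"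
  "one (K_T n E) = one Phi.Q" "module.smult (K_T n E) = module.smult Phi.Q"
  by (simp_all add: K_T_def generated_subalg_def Phi_T_def)

text \<open>One direction is well-definedness of the map on cosets, the other its
  injectivity.\<close>

lemma D_cls_eq_iff:
  fixes p q :: "(nat, 'k::field_char_0) mpoly"
  assumes "p \<in> polys {0..n}" "q \<in> polys {0..n}"
  shows "D.cls p = D.cls q \<longleftrightarrow> Phi.cls (\<theta> p) = Phi.cls (\<theta> q)"
  unfolding D.cls_eq_iff Phi.cls_eq_iff subst_diff[symmetric]
  using assms subst_Y_poly_D_ideal[OF G] D_ideal_if_subst_Y_poly[OF G] by blast

lemma D_T_K_T_isomorphic:
  "filtered_alg_isomorphic
     (D_T n E :: ('k::field_char_0, (nat, 'k) mpoly set) module) (D_T_filtration n E)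
     (K_T n E :: ('k, (nat set, 'k) mpoly set) module) (K_T_filtration n E)"
proof -
  \<comment> \<open>The union runs over representatives that all give the same class, so no
    representative has to be chosen.\<close>
  define h where "h S = (\<Union>p\<in>S. Phi.cls (\<theta> p))" for S :: "(nat, 'k) mpoly set"
  have h: "h (D.cls p) = Phi.cls (\<theta> p)" if p: "p \<in> polys {0..n}" for p
  proof -
    have "Phi.cls (\<theta> x) = Phi.cls (\<theta> p)" if x: "x \<in> D.cls p" for x
    proof -
      obtain a where a: "a \<in> D_ideal n E" "x = a + p" using x by (auto simp: D.cls_def')
      then have "x \<in> polys {0..n}" "D.cls x = D.cls p" using D.I_props(1) p by (auto simp: D.cls_eq_iff)
      then show ?thesis using D_cls_eq_iff p by blast
    qed
    moreover have "D.cls p \<noteq> {}" using D.I_props(2) by (auto simp: D.cls_def')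
    ultimately show ?thesis by (simp add: h_def)
  qed
  have carrier_D: "carrier (D_T n E) = D.cls ` (polys {0..n} :: (nat, 'k) mpoly set)"
    by (simp add: D_T_def D.carrier_Q)
  have "h \<in> ring_hom (D_T n E) (K_T n E)"
  proof (rule ring_hom_memI)
    fix x y :: "(nat, 'k) mpoly set"
    assume "x \<in> carrier (D_T n E)" "y \<in> carrier (D_T n E)"
    then obtain p q where pq: "p \<in> polys {0..n}" "q \<in> polys {0..n}" "x = D.cls p" "y = D.cls q"
      by (auto simp: carrier_D)
    show "h x \<in> carrier (K_T n E)" using pq by (auto simp: h carrier_K_T)
    show "h (x \<otimes>\<^bsub>D_T n E\<^esub> y) = h x \<otimes>\<^bsub>K_T n E\<^esub> h y"
      using pq by (simp add: K_T_sel D_T_def D.mult_Q h Phi.mult_Q subst_Y_poly_polys subst_mult)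
    show "h (x \<oplus>\<^bsub>D_T n E\<^esub> y) = h x \<oplus>\<^bsub>K_T n E\<^esub> h y"
      using pq by (simp add: K_T_sel D_T_def D.add_Q h Phi.add_Q subst_Y_poly_polys subst_add)
  next
    show "h \<one>\<^bsub>D_T n E\<^esub> = \<one>\<^bsub>K_T n E\<^esub>"
      by (simp add: K_T_sel D_T_def D.one_Q Phi.one_Q h)
  qed
  moreover have "bij_betw h (carrier (D_T n E)) (carrier (K_T n E))"
    unfolding carrier_D carrier_K_T
    by (rule bij_betw_imageI) (auto simp: inj_on_def h D_cls_eq_iff image_image intro!: image_cong)
  moreover have "h (c \<odot>\<^bsub>D_T n E\<^esub> x) = c \<odot>\<^bsub>K_T n E\<^esub> h x" 
    if x: "x \<in> carrier (D_T n E)" for c and x :: "(nat, 'k) mpoly set"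
  proof -
    obtain p where "p \<in> polys {0..n}" "x = D.cls p" using x by (auto simp: carrier_D)
    then show ?thesis by (simp add: K_T_sel D_T_def D.smult_Q h Phi.smult_Q subst_mult)
  qed
  ultimately have "h \<in> alg_iso (D_T n E) (K_T n E)"
    by (simp add: alg_iso_def ring_iso_def)
  moreover have "h ` D_T_filtration n E k = K_T_filtration n E k" for k
  proof -
    have "D_T_filtration n E k = D.cls ` {p :: (nat, 'k) mpoly. p \<in> polys {0..n} \<and> total_degree_le p k}"
      by (auto simp: D_T_filtration_def)
    then show ?thesis unfolding K_T_filtration_eq by (auto simp: image_image h intro!: image_cong)
  qed
  ultimately show ?thesis unfolding filtered_alg_isomorphic_def by blast
qed

end

theorem theorem9:
  fixes n :: nat and E :: "nat set set"
  assumes "simple_graph n E"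
  shows "filtered_alg_isomorphic
           (D_T n E :: ('k::field_char_0, (nat, 'k) mpoly set) module) (D_T_filtration n E)
           (K_T n E :: ('k, (nat set, 'k) mpoly set) module) (K_T_filtration n E)"
  using assms by (rule D_T_K_T_isomorphic)

end
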